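(* Let $E$ be a finite directed graph with talented monoid $T_E$, regarded as a $\mathbb Z$-monoid. There is a one-to-one correspondence between the cycles with no exits in $E$ and the cyclic minimal $\mathbb Z$-order-ideals of $T_E$. Furthermore, the sum of all cyclic minimal $\mathbb Z$-order-ideals, which is the $\mathbb Z$-order-ideal generated by the vertices on cycles with no exits, is the largest cyclic $\mathbb Z$-order-ideal of $T_E$.
   Context: A directed graph $E=(E^0,E^1,r,s)$ has vertex set $E^0$, edge set $E^1$ and range and source maps $r,s:E^1\to E^0$; it is finite if $E^0$ and $E^1$ are finite. A vertex $v$ is a sink if $s^{-1}(v)=\emptyset$. A cycle is a path $e_1\cdots e_n$, $n\ge1$ (edges with $r(e_i)=s(e_{i+1})$), with $r(e_n)=s(e_1)$ and $s(e_1),\dots,s(e_n)$ pairwise distinct; cycles which differ only by the choice of starting vertex (cyclic rotation) are identified. An exit of the cycle is an edge $f$ with $s(f)=s(e_i)$ and $f\neq e_i$ for some $i$. The talented monoid $T_E$ is the commutative monoid generated by $\{v(i)\mid v\in E^0,\ i\in\mathbb Z\}$ subject to $v(i)=\sum_{e\in s^{-1}(v)}r(e)(i+1)$ for all $i\in\mathbb Z$ and all $v\in E^0$ that are not sinks. The group $\mathbb Z$ acts on it by ${}^nv(i)=v(i+n)$; a vertex $v$ is identified with the element $v(0)$ of $T_E$. A $\mathbb Z$-order-ideal of $T_E$ is a submonoid $I$ closed under the $\mathbb Z$-action such that $a+b\in I$ implies $a,b\in I$. It is cyclic if for every $x\in I$ there is $0\neq n\in\mathbb Z$ with ${}^nx=x$.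 It is minimal if it is minimal among the non-zero $\mathbb Z$-order-ideals. *)

theory Defs
  imports
    "Graph_Theory.Arc_Walk"
    "HOL-Library.Multiset"
    "HOL-Algebra.Group"
    "HOL-Algebra.FiniteProduct"
    "HOL.Hull"
begin

section \<open>Monoids with an action of the integers\<close>

text \<open>
  Commutative monoids are written multiplicatively, following HOL-Algebra: the
  sum and the zero element of the additive notation are \<open>\<otimes>\<close> and \<open>\<one>\<close>.
\<close>

record 'm int_monoid = "'m monoid" +
  act :: "int \<Rightarrow> 'm \<Rightarrow> 'm"

locale Z_monoid = comm_monoid M for M :: "('m, 'x) int_monoid_scheme" (structure) +
  assumes act_hom: "act M n \<in> hom M M"
    and act_one: "act M n \<one> = \<one>"
    and act_zero: "x \<in> carrier M \<Longrightarrow> act M 0 x = x"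
    and act_add: "x \<in> carrier M \<Longrightarrow> act M (m + n) x = act M m (act M n x)"

definition Z_order_ideal :: "('m, 'x) int_monoid_scheme \<Rightarrow> 'm set \<Rightarrow> bool" where
  "Z_order_ideal M I \<longleftrightarrow>
     submonoid I M \<and>
     (\<forall>n. \<forall>x\<in>I. act M n x \<in> I) \<and>
     (\<forall>a\<in>carrier M. \<forall>b\<in>carrier M. a \<otimes>\<^bsub>M\<^esub> b \<in> I \<longrightarrow> a \<in> I \<and> b \<in> I)"

definition cyclic_Z_order_ideal :: "('m, 'x) int_monoid_scheme \<Rightarrow> 'm set \<Rightarrow> bool" where
  "cyclic_Z_order_ideal M I \<longleftrightarrow>
     Z_order_ideal M I \<and> (\<forall>x\<in>I. \<exists>n. n \<noteq> 0 \<and> act M n x = x)"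

definition minimal_Z_order_ideal :: "('m, 'x) int_monoid_scheme \<Rightarrow> 'm set \<Rightarrow> bool" where
  "minimal_Z_order_ideal M I \<longleftrightarrow>
     Z_order_ideal M I \<and> I \<noteq> {\<one>\<^bsub>M\<^esub>} \<and>
     (\<forall>J. Z_order_ideal M J \<and> J \<noteq> {\<one>\<^bsub>M\<^esub>} \<and> J \<subseteq> I \<longrightarrow> J = I)"

definition largest_cyclic_Z_order_ideal :: "('m, 'x) int_monoid_scheme \<Rightarrow> 'm set \<Rightarrow> bool" where
  "largest_cyclic_Z_order_ideal M I \<longleftrightarrow>
     cyclic_Z_order_ideal M I \<and> (\<forall>J. cyclic_Z_order_ideal M J \<longrightarrow> J \<subseteq> I)"

definition generated_Z_order_ideal :: "('m, 'x) int_monoid_scheme \<Rightarrow> 'm set \<Rightarrow> 'm set" where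
  "generated_Z_order_ideal M X = Z_order_ideal M hull X"

text \<open>
  The sum of a possibly infinite family of submonoids: all finite sums with at
  most one summand from each member.  The empty family has sum \<open>{\<one>}\<close>.
\<close>

definition family_sum :: "('m, 'x) monoid_scheme \<Rightarrow> 'm set set \<Rightarrow> 'm set" where
  "family_sum M \<I> =
     {finprod M f \<F> | f \<F>. finite \<F> \<and> \<F> \<subseteq> \<I> \<and> (\<forall>J\<in>\<F>. f J \<in> J)}"


section \<open>The talented monoid\<close>

text \<open>
  The free commutative monoid on the symbols \<open>v(i)\<close> consists of the finite
  multisets over \<open>verts G \<times> UNIV\<close>, where \<open>(v, i)\<close> stands for \<open>v(i)\<close>.
  The talented monoid is its quotient by the least congruence containing the
  defining relations.  Source and range are \<^const>\<open>tail\<close> and \<^const>\<open>head\<close>.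
\<close>

definition talented_words :: "('v, 'e) pre_digraph \<Rightarrow> ('v \<times> int) multiset set" where
  "talented_words G = {x. set_mset x \<subseteq> verts G \<times> UNIV}"

inductive talented_cong ::
  "('v, 'e) pre_digraph \<Rightarrow> ('v \<times> int) multiset \<Rightarrow> ('v \<times> int) multiset \<Rightarrow> bool"
  for G :: "('v, 'e) pre_digraph" where
  expand: "v \<in> verts G \<Longrightarrow> out_arcs G v \<noteq> {} \<Longrightarrow>
    talented_cong G {#(v, i)#} (\<Sum>e\<in>out_arcs G v. {#(head G e, i + 1)#})"
| refl: "x \<in> talented_words G \<Longrightarrow> talented_cong G x x"
| sym: "talented_cong G x y \<Longrightarrow> talented_cong G y x"
| trans: "talented_cong G x y \<Longrightarrow> talented_cong G y z \<Longrightarrow> talented_cong G x z"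
| add: "talented_cong G x y \<Longrightarrow> talented_cong G x' y' \<Longrightarrow> talented_cong G (x + x') (y + y')"

definition talented_rel :: "('v, 'e) pre_digraph \<Rightarrow> ('v \<times> int) multiset rel" where
  "talented_rel G = {(x, y). talented_cong G x y}"

definition shift_word :: "int \<Rightarrow> ('v \<times> int) multiset \<Rightarrow> ('v \<times> int) multiset" where
  "shift_word n = image_mset (\<lambda>(v, i). (v, i + n))"

definition talented_monoid ::
  "('v, 'e) pre_digraph \<Rightarrow> ('v \<times> int) multiset set int_monoid" where
  "talented_monoid G =
     \<lparr>carrier = talented_words G // talented_rel G,
      mult = (\<lambda>X Y. talented_rel G `` {x + y | x y. x \<in> X \<and> y \<in> Y}),
      one = talented_rel G `` {{#}},
      act = (\<lambda>n X. talented_rel G `` (shift_word n ` X))\<rparr>"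

text \<open>The vertex \<open>v\<close>, identified with the class of \<open>v(0)\<close>.\<close>

definition vertex_class :: "('v, 'e) pre_digraph \<Rightarrow> 'v \<Rightarrow> ('v \<times> int) multiset set" where
  "vertex_class G v = talented_rel G `` {{#(v, 0)#}}"


section \<open>Cycles without exits\<close>

text \<open>
  The library predicate \<^const>\<open>pre_digraph.cycle\<close> asks for a nonempty closed
  walk whose edges have pairwise distinct heads; on a closed walk this is the
  same as pairwise distinct tails.
\<close>

lemma (in pre_digraph) cycle_iff_distinct_tails:
  "cycle p \<longleftrightarrow> p \<noteq> [] \<and> (\<exists>u. awalk u p u) \<and> distinct (map (tail G) p)"
proof -
  have cas_last: "cas u q v \<Longrightarrow> q \<noteq> [] \<Longrightarrow> head G (last q) = v" for u q v
    by (induction u q v rule: cas.induct) (auto split: if_splits)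
  have "distinct (tl (awalk_verts u p)) \<longleftrightarrow> distinct (map (tail G) p)"
    if w: "awalk u p u" and ne: "p \<noteq> []" for u
  proof -
    obtain e es where p: "p = e # es" using ne by (cases p) auto
    have c: "cas u p u" using w by (simp add: awalk_def)
    have t: "tail G e = u" using c p by simp
    have h: "head G (last p) = u" using cas_last c ne by blast
    have "awalk_verts u p = map (tail G) p @ [u]"
      using ne h by (simp add: awalk_verts_conv)
    then have "tl (awalk_verts u p) = map (tail G) es @ [tail G e]"
      using p t by simp
    then show ?thesis using p by auto
  qed
  then show ?thesis unfolding cycle_def by blast
qed

definition has_exit :: "('v, 'e) pre_digraph \<Rightarrow> 'e list \<Rightarrow> bool" where
  "has_exit G p \<longleftrightarrow> (\<exists>e\<in>set p. \<exists>f\<in>arcs G. tail G f = tail G e \<and> f \<noteq> e)"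

definition exitless_cycle :: "('v, 'e) pre_digraph \<Rightarrow> 'e list \<Rightarrow> bool" where
  "exitless_cycle G p \<longleftrightarrow> pre_digraph.cycle G p \<and> \<not> has_exit G p"

definition rotation_rel :: "'e list rel" where
  "rotation_rel = {(p, q). \<exists>k. q = rotate k p}"

definition exitless_cycles :: "('v, 'e) pre_digraph \<Rightarrow> 'e list set set" where
  "exitless_cycles G = {p. exitless_cycle G p} // rotation_rel"

definition cycle_verts :: "('v, 'e) pre_digraph \<Rightarrow> 'e list set \<Rightarrow> 'v set" where
  "cycle_verts G C = (\<Union>p\<in>C. tail G ` set p)"


section \<open>The talented monoid is a commutative monoid with an action of the integers\<close>

lemma (in fin_digraph) talented_cong_words:
  "talented_cong G x y \<Longrightarrow> x \<in> talented_words G \<and> y \<in> talented_words G"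
proof (induction rule: talented_cong.induct)
  case (expand v i)
  have "finite (out_arcs G v)"
    by (rule finite_subset[OF _ finite_arcs]) (auto simp: out_arcs_def)
  then show ?case using expand
    by (auto simp: talented_words_def set_mset_sum out_arcs_def)
qed (auto simp: talented_words_def)

lemma shift_word_simps [simp]:
  "shift_word n {#} = {#}"
  "shift_word n (x + y) = shift_word n x + shift_word n y"
  "shift_word n {#(v, i)#} = {#(v, i + n)#}"
  "shift_word 0 x = x"
  "shift_word m (shift_word n x) = shift_word (m + n) x"
  by (auto simp: shift_word_def multiset.map_comp intro!: multiset.map_cong)

lemma shift_word_sum: "shift_word n (sum f A) = (\<Sum>a\<in>A. shift_word n (f a))"
  by (induction A rule: infinite_finite_induct) auto

lemma shift_word_words: "x \<in> talented_words G \<Longrightarrow> shift_word n x \<in> talented_words G"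
  by (auto simp: talented_words_def shift_word_def)

lemma talented_cong_shift:
  "talented_cong G x y \<Longrightarrow> talented_cong G (shift_word n x) (shift_word n y)"
proof (induction rule: talented_cong.induct)
  case (expand v i)
  from talented_cong.expand[OF this, of "i + n"] show ?case
    by (simp add: shift_word_sum algebra_simps)
qed (auto intro: talented_cong.intros simp: shift_word_words)

lemma (in fin_digraph) equiv_talented_rel: "equiv (talented_words G) (talented_rel G)"
  by (rule equivI)
    (auto simp: talented_rel_def refl_on_def sym_def trans_def
      dest: talented_cong_words intro: talented_cong.intros)

lemma (in fin_digraph) talented_class_Image:
  assumes "x \<in> A" and "\<And>y. y \<in> A \<Longrightarrow> talented_cong G x y"
  shows "talented_rel G `` A = talented_rel G `` {x}"
proof (intro equalityI subsetI)
  fix z assume "z \<in> talented_rel G `` A"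
  then obtain y where "y \<in> A" "talented_cong G y z" by (auto simp: talented_rel_def)
  then have "talented_cong G x z" using assms(2) talented_cong.trans by blast
  then show "z \<in> talented_rel G `` {x}" by (simp add: talented_rel_def)
next
  fix z assume "z \<in> talented_rel G `` {x}"
  then show "z \<in> talented_rel G `` A" using assms(1) by blast
qed

lemma (in fin_digraph) talented_class_mult:
  assumes "x \<in> talented_words G" "y \<in> talented_words G"
  shows "mult (talented_monoid G) (talented_rel G `` {x}) (talented_rel G `` {y})
    = talented_rel G `` {x + y}"
  unfolding talented_monoid_def monoid.simps
proof (rule talented_class_Image)
  have "x \<in> talented_rel G `` {x}" "y \<in> talented_rel G `` {y}"
    using assms by (simp_all add: talented_rel_def talented_cong.refl)
  then show "x + y \<in> {u + v | u v. u \<in> talented_rel G `` {x} \<and> v \<in> talented_rel G `` {y}}"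
    by blast
next
  fix z assume "z \<in> {u + v | u v. u \<in> talented_rel G `` {x} \<and> v \<in> talented_rel G `` {y}}"
  then obtain u v where "z = u + v" "talented_cong G x u" "talented_cong G y v"
    by (auto simp: talented_rel_def)
  then show "talented_cong G (x + y) z" by (simp add: talented_cong.add)
qed

lemma (in fin_digraph) talented_class_act:
  assumes "x \<in> talented_words G"
  shows "act (talented_monoid G) n (talented_rel G `` {x}) = talented_rel G `` {shift_word n x}"
  unfolding talented_monoid_def int_monoid.simps
proof (rule talented_class_Image)
  have "x \<in> talented_rel G `` {x}"
    using assms by (simp add: talented_rel_def talented_cong.refl)
  then show "shift_word n x \<in> shift_word n ` talented_rel G `` {x}" by blast
next
  fix z assume "z \<in> shift_word n ` talented_rel G `` {x}"
  then show "talented_cong G (shift_word n x) z"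
    by (auto simp: talented_rel_def intro: talented_cong_shift)
qed

lemma (in fin_digraph) Z_monoid_talented_monoid: "Z_monoid (talented_monoid G)"
proof -
  let ?T = "talented_monoid G" and ?c = "\<lambda>x. talented_rel G `` {x}"
  have car: "carrier ?T = ?c ` talented_words G"
    by (auto simp: talented_monoid_def quotient_def)
  have one: "one ?T = ?c {#}" by (simp add: talented_monoid_def)
  have w0: "{#} \<in> talented_words G" by (simp add: talented_words_def)
  have wa: "x + y \<in> talented_words G"
    if "x \<in> talented_words G" "y \<in> talented_words G" for x y
    using that by (auto simp: talented_words_def)
  note simps = car one w0 wa talented_class_mult talented_class_act shift_word_words
  have "comm_monoid ?T"
    by (rule comm_monoidI) (auto simp: simps ac_simps)
  moreover have "Z_monoid_axioms ?T"
    by (rule Z_monoid_axioms.intro) (auto simp: simps hom_def)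
  ultimately show ?thesis by (rule Z_monoid.intro)
qed

end

theory Submission
  imports Defs
begin

text \<open>
  The order ideals of the talented monoid correspond to the hereditary saturated sets of vertices,
  so everything is a statement about such sets.  Replacing symbols \<open>v(i)\<close> repeatedly by their
  defining sums until they sit on level \<open>n\<close> or at a sink is deterministic, and two words are
  congruent iff they become equal for all large \<open>n\<close>.  If \<open>v\<close> is periodic, the unfoldings of \<open>v\<close>
  are eventually periodic up to a shift; since their size never decreases, it is eventually constant,
  and no sink occurs, because a sink keeps its level.  Hence the vertices that occur eventually emit
  exactly one edge each, and finiteness forces their paths into cycles without exits.  So the largest
  cyclic ideal corresponds to the hereditary saturated closure of those cycles, and a single cycle
  gives a minimal ideal since any hereditary set that meets the cycle contains it.
\<close>

section \<open>Auxiliary facts on multisets\<close>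

lemma sum_mset_image_sum:
  "sum_mset (image_mset f (sum g A)) = (\<Sum>a\<in>A. sum_mset (image_mset f (g a)))"
  by (induction A rule: infinite_finite_induct) auto

lemma fst_set_shift_word [simp]: "fst ` set_mset (shift_word n x) = fst ` set_mset x"
  by (force simp: shift_word_def)

lemma size_shift_word [simp]: "size (shift_word n x) = size x"
  by (simp add: shift_word_def)

text \<open>Removing \<open>a\<close> from \<open>M\<close> leaves an inequality between the two
  sums, so a strict excess at \<open>a\<close> could not be made up elsewhere. This later forces
  out-degrees to be one.\<close>

lemma sum_mset_le_eqD:
  fixes f g :: "'a \<Rightarrow> nat"
  assumes "\<And>a. a \<in># M \<Longrightarrow> f a \<le> g a"
    and "sum_mset (image_mset g M) = sum_mset (image_mset f M)" and "a \<in># M"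
  shows "g a = f a"
proof -
  obtain N where M: "M = add_mset a N" using assms(3) by (meson mset_add)
  have "sum_mset (image_mset f N) \<le> sum_mset (image_mset g N)"
    by (rule sum_mset_mono) (use assms(1) M in auto)
  then show ?thesis using assms(1)[OF assms(3)] assms(2) M by simp
qed

text \<open>Serves to split a word into one summand per ideal, the form in which
  \<open>family_sum\<close> presents its elements.\<close>

lemma sum_filter_mset_partition:
  assumes "finite \<F>" and "g ` set_mset x \<subseteq> \<F>"
  shows "(\<Sum>J\<in>\<F>. filter_mset (\<lambda>a. g a = J) x) = x"
proof (rule multiset_eqI)
  fix a
  have "count (\<Sum>J\<in>\<F>. filter_mset (\<lambda>a. g a = J) x) a = (\<Sum>J\<in>\<F>. if g a = J then count x a else 0)"
    using assms(1) by (simp add: count_sum)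
  also have "\<dots> = count x a"
    using assms by (auto simp: sum.delta' count_eq_zero_iff)
  finally show "count (\<Sum>J\<in>\<F>. filter_mset (\<lambda>a. g a = J) x) a = count x a" .
qed

section \<open>Hereditary saturated sets and unfolding of words\<close>

context pre_digraph
begin

text \<open>
  The sets need not consist of vertices only; thus they are closed under all intersections, the empty
  one included, and \<open>hull\<close> yields the closure.
\<close>

definition hereditary_saturated :: "'a set \<Rightarrow> bool" where
  "hereditary_saturated H \<longleftrightarrow>
     (\<forall>v\<in>verts G. out_arcs G v \<noteq> {} \<longrightarrow> (v \<in> H \<longleftrightarrow> head G ` out_arcs G v \<subseteq> H))"

text \<open>Each round applies the defining relation to every letter at once. After \<open>k\<close>
  rounds a letter sits at level \<open>i + k\<close> or at a sink.\<close>

primrec unfold :: "nat \<Rightarrow> 'a \<Rightarrow> int \<Rightarrow> ('a \<times> int) multiset" where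
  "unfold 0 v i = {#(v, i)#}"
| "unfold (Suc k) v i =
     (if out_arcs G v = {} then {#(v, i)#} else \<Sum>e\<in>out_arcs G v. unfold k (head G e) (i + 1))"

text \<open>The ends of the paths of length \<open>k\<close> from \<open>v\<close>, together with
  the sinks met earlier. The start level 0 is arbitrary, by \<open>fst_set_unfold\<close>.\<close>

definition descendants :: "nat \<Rightarrow> 'a \<Rightarrow> 'a set" where
  "descendants k v = fst ` set_mset (unfold k v 0)"

text \<open>Letters below level \<open>n\<close> are raised to it unless a sink stops them. Since
  \<open>nat\<close> truncates at 0, letters above level \<open>n\<close> stay put, so congruent
  words need agree only for large \<open>n\<close>.\<close>

definition normal :: "int \<Rightarrow> ('a \<times> int) multiset \<Rightarrow> ('a \<times> int) multiset" where
  "normal n x = sum_mset (image_mset (\<lambda>(v, i). unfold (nat (n - i)) v i) x)"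

lemma normal_add [simp]: "normal n (x + y) = normal n x + normal n y"
  by (simp add: normal_def)

lemma normal_single [simp]: "normal n {#(v, i)#} = unfold (nat (n - i)) v i"
  by (simp add: normal_def)

lemma hereditary_saturated_Inter:
  "(\<And>H. H \<in> \<H> \<Longrightarrow> hereditary_saturated H) \<Longrightarrow> hereditary_saturated (\<Inter>\<H>)"
  unfolding hereditary_saturated_def by blast

lemma hereditary_saturated_hull: "hereditary_saturated (hereditary_saturated hull X)"
  by (rule hull_in) (auto intro: hereditary_saturated_Inter)

lemma shift_word_unfold: "shift_word n (unfold k v i) = unfold k v (i + n)"
  by (induction k arbitrary: v i) (auto simp: shift_word_sum algebra_simps)

lemma unfold_sink: "out_arcs G v = {} \<Longrightarrow> unfold k v i = {#(v, i)#}"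
  by (cases k) auto

text \<open>A sink met during the first \<open>k\<close> rounds is fixed by the remaining
  \<open>l\<close>, so the induction also passes through sinks.\<close>

lemma unfold_plus:
  "unfold (k + l) v i = sum_mset (image_mset (\<lambda>(w, j). unfold l w j) (unfold k v i))"
  by (induction k arbitrary: v i) (auto simp: sum_mset_image_sum unfold_sink)

end

section \<open>Normal forms of words and descendants of vertices in a finite graph\<close>

context fin_digraph
begin

lemma finite_out_arcs [simp]: "finite (out_arcs G v)"
  by (rule finite_subset[OF _ finite_arcs]) (auto simp: out_arcs_def)

text \<open>The two sides of a defining relation unfold alike once \<open>n\<close> is above the
  level of the left one; transitivity and addition take the maximum of two thresholds.\<close>

lemma normal_cong:
  "talented_cong G x y \<Longrightarrow> \<exists>n0. \<forall>n\<ge>n0. normal n x = normal n y"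
proof (induction rule: talented_cong.induct)
  case (expand v i)
  have "normal n {#(v, i)#} = normal n (\<Sum>e\<in>out_arcs G v. {#(head G e, i + 1)#})"
    if "n \<ge> i + 1" for n
  proof -
    \<comment> \<open>The \<open>Suc\<close> exposes the first round of unfolding, which is the
      defining relation itself.\<close>
    have "nat (n - i) = Suc (nat (n - (i + 1)))" using that by simp
    then show ?thesis using expand by (simp add: normal_def sum_mset_image_sum)
  qed
  then show ?case by blast
next
  case (trans x y z)
  then obtain a b where "\<forall>n\<ge>a. normal n x = normal n y" "\<forall>n\<ge>b. normal n y = normal n z" by blast
  then have "\<forall>n\<ge>max a b. normal n x = normal n z" by simp
  then show ?case by blast
next
  case (add x y x' y')
  then obtain a b where "\<forall>n\<ge>a. normal n x = normal n y" "\<forall>n\<ge>b. normal n x' = normal n y'" by blast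
  then have "\<forall>n\<ge>max a b. normal n (x + x') = normal n (y + y')" by simp
  then show ?case by blast
next
  case (sym x y)
  then show ?case by metis
qed (auto intro: exI[of _ 0])

lemma talented_words_simps [simp]:
  "{#} \<in> talented_words G"
  "{#(v, i)#} \<in> talented_words G \<longleftrightarrow> v \<in> verts G"
  "x + y \<in> talented_words G \<longleftrightarrow> x \<in> talented_words G \<and> y \<in> talented_words G"
  "shift_word n x \<in> talented_words G \<longleftrightarrow> x \<in> talented_words G"
  by (force simp: talented_words_def shift_word_def)+

lemma talented_cong_sum:
  assumes "finite A" and "\<And>a. a \<in> A \<Longrightarrow> talented_cong G (f a) (g a)"
  shows "talented_cong G (sum f A) (sum g A)"
  using assms by (induction A rule: finite_induct) (auto intro: talented_cong.intros)

lemma talented_cong_unfold: "v \<in> verts G \<Longrightarrow> talented_cong G {#(v, i)#} (unfold k v i)"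
proof (induction k arbitrary: v i)
  case (Suc k)
  show ?case
  proof (cases "out_arcs G v = {}")
    case False
    have "talented_cong G (\<Sum>e\<in>out_arcs G v. {#(head G e, i + 1)#})
            (\<Sum>e\<in>out_arcs G v. unfold k (head G e) (i + 1))"
      by (rule talented_cong_sum) (auto intro: Suc.IH)
    then show ?thesis
      using False talented_cong.expand[OF Suc.prems False] by (auto intro: talented_cong.trans)
  qed (use Suc.prems in \<open>auto intro: talented_cong.refl\<close>)
qed (auto intro: talented_cong.refl)

lemma set_mset_unfold_Suc:
  "out_arcs G v \<noteq> {} \<Longrightarrow>
   set_mset (unfold (Suc k) v i) = (\<Union>e\<in>out_arcs G v. set_mset (unfold k (head G e) (i + 1)))"
  by (simp add: set_mset_sum)

lemma unfold_nonempty: "unfold k v i \<noteq> {#}"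
proof (induction k arbitrary: v i)
  case (Suc k)
  show ?case
  proof (cases "out_arcs G v = {}")
    case False
    then obtain e where "e \<in> out_arcs G v" by blast
    moreover obtain a where "a \<in># unfold k (head G e) (i + 1)"
      using Suc by (meson multiset_nonemptyE)
    ultimately have "a \<in># unfold (Suc k) v i"
      using set_mset_unfold_Suc[OF False] by blast
    then show ?thesis by (metis empty_iff set_mset_empty)
  qed simp
qed simp

text \<open>Rounds never lower a level; this bound will contradict a sink in a periodic
  unfolding.\<close>

lemma unfold_level: "(w, j) \<in># unfold k v i \<Longrightarrow> i \<le> j"
proof (induction k arbitrary: v i)
  case (Suc k)
  then show ?case
    by (cases "out_arcs G v = {}") (force simp: set_mset_sum)+
qed auto

lemma fst_set_unfold: "fst ` set_mset (unfold k v i) = descendants k v"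
  using fst_set_shift_word[of i "unfold k v 0"] by (simp add: shift_word_unfold descendants_def)

lemma descendants_0 [simp]: "descendants 0 v = {v}"
  by (simp add: descendants_def)

lemma descendants_Suc:
  "descendants (Suc k) v =
     (if out_arcs G v = {} then {v} else \<Union>e\<in>out_arcs G v. descendants k (head G e))"
proof (cases "out_arcs G v = {}")
  case False
  then show ?thesis
    unfolding fst_set_unfold[of _ _ 0, symmetric] set_mset_unfold_Suc[OF False] image_UN
    by (simp add: fst_set_unfold)
qed (simp add: descendants_def)

text \<open>Peeling off first arcs reduces to \<open>k = 0\<close>, where \<open>v\<close> lies in
  \<open>X\<close> and heredity keeps all further descendants there. Thus surplus rounds do no
  harm.\<close>

lemma descendants_hereditary:
  assumes X: "\<And>v. v \<in> X \<Longrightarrow> head G ` out_arcs G v \<subseteq> X"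
  shows "descendants k v \<subseteq> X \<Longrightarrow> descendants (k + l) v \<subseteq> X"
proof (induction k arbitrary: v)
  case 0
  then have "v \<in> X" by simp
  then have "descendants l v \<subseteq> X"
  proof (induction l arbitrary: v)
    case (Suc l)
    then show ?case using X[OF Suc.prems] unfolding descendants_Suc by auto
  qed simp
  then show ?case by simp
next
  case (Suc k)
  then show ?case unfolding add_Suc descendants_Suc by (auto split: if_splits)
qed

text \<open>This is the explicit saturation of a hereditary \<open>X\<close>: one round more gives
  heredity, and a number of rounds common to all arcs gives saturation.\<close>

lemma hereditary_saturated_descendants:
  assumes X: "\<And>v. v \<in> X \<Longrightarrow> head G ` out_arcs G v \<subseteq> X"
  shows "hereditary_saturated {v. \<exists>k. descendants k v \<subseteq> X}"
    (is "hereditary_saturated ?H")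
  unfolding hereditary_saturated_def
proof (intro ballI impI iffI)
  fix v assume ne: "out_arcs G v \<noteq> {}"
  have step: "descendants (Suc k) v \<subseteq> X \<longleftrightarrow> (\<forall>e\<in>out_arcs G v. descendants k (head G e) \<subseteq> X)" for k
    using ne unfolding descendants_Suc by auto
  {
    assume "v \<in> ?H"
    then obtain k where "descendants k v \<subseteq> X" by blast
    then have "descendants (Suc k) v \<subseteq> X"
      using descendants_hereditary[OF X, of k v 1] by simp
    then show "head G ` out_arcs G v \<subseteq> ?H" using step by blast
  next
    assume "head G ` out_arcs G v \<subseteq> ?H"
    then have "\<forall>e\<in>out_arcs G v. \<exists>k. descendants k (head G e) \<subseteq> X" by blast
    then obtain k where k: "\<forall>e\<in>out_arcs G v. descendants (k e) (head G e) \<subseteq> X"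
      by metis
    \<comment> \<open>The sum of the \<open>k e\<close> serves as a common number of rounds for the
      finitely many arcs.\<close>
    have "descendants (\<Sum>e\<in>out_arcs G v. k e) (head G e) \<subseteq> X" if "e \<in> out_arcs G v" for e
    proof -
      have "k e \<le> (\<Sum>e\<in>out_arcs G v. k e)"
        by (rule member_le_sum[OF that]) auto
      then obtain l where l: "(\<Sum>e\<in>out_arcs G v. k e) = k e + l" using le_Suc_ex by blast
      show ?thesis unfolding l
        by (rule descendants_hereditary[OF X]) (use k that in auto)
    qed
    then show "v \<in> ?H" using step by blast
  }
qed

text \<open>Support in \<open>H\<close> is an invariant of the class: heredity transports it along a
  defining relation from left to right, saturation from right to left.\<close>

lemma talented_cong_hereditary_saturated:
  "talented_cong G x y \<Longrightarrow> hereditary_saturated H \<Longrightarrow>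
   fst ` set_mset x \<subseteq> H \<longleftrightarrow> fst ` set_mset y \<subseteq> H"
proof (induction rule: talented_cong.induct)
  case (expand v i)
  then show ?case
    by (auto simp: set_mset_sum hereditary_saturated_def image_subset_iff)
qed (auto simp: image_Un)

lemma descendants_hereditary_saturated:
  "v \<in> verts G \<Longrightarrow> hereditary_saturated H \<Longrightarrow> descendants k v \<subseteq> H \<longleftrightarrow> v \<in> H"
  using talented_cong_hereditary_saturated[OF talented_cong_unfold[of v 0 k]]
  by (auto simp: descendants_def)

lemma descendants_nonempty: "descendants k v \<noteq> {}"
  using unfold_nonempty by (simp add: descendants_def)

lemma hereditary_saturatedD:
  "hereditary_saturated H \<Longrightarrow> v \<in> H \<Longrightarrow> v \<in> verts G \<Longrightarrow> e \<in> out_arcs G v \<Longrightarrow> head G e \<in> H"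
  unfolding hereditary_saturated_def by blast

end

section \<open>Exitless cycles and periodic vertices\<close>

context pre_digraph
begin

text \<open>Meaningful where \<open>v\<close> emits exactly one arc; on such vertices
  \<open>next_vert\<close> is the successor map.\<close>

definition out_arc :: "'a \<Rightarrow> 'b" where
  "out_arc v = (SOME e. e \<in> out_arcs G v)"

definition next_vert :: "'a \<Rightarrow> 'a" where
  "next_vert v = head G (out_arc v)"

text \<open>The path followed from \<open>v\<close> up to its first return to \<open>v\<close>. For
  a vertex on an exitless cycle it is the rotation of the cycle that starts at
  \<open>v\<close>.\<close>

definition loop :: "'a \<Rightarrow> 'b list" where
  "loop v = map (\<lambda>i. out_arc ((next_vert ^^ i) v)) [0..<(LEAST n. 0 < n \<and> (next_vert ^^ n) v = v)]"

definition exitless_verts :: "'a set" where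
  "exitless_verts = {v. \<exists>p. exitless_cycle G p \<and> v \<in> tail G ` set p}"

lemma out_arc_eq: "out_arcs G v = {e} \<Longrightarrow> out_arc v = e"
  by (simp add: out_arc_def)

lemma cas_snoc: "cas u p v \<Longrightarrow> tail G e = v \<Longrightarrow> cas u (p @ [e]) (head G e)"
  by (induction p arbitrary: u) (auto simp del: cas_append_iff)

lemma cas_nth: "cas u p v \<Longrightarrow> Suc i < length p \<Longrightarrow> head G (p ! i) = tail G (p ! Suc i)"
proof (induction u p v arbitrary: i rule: cas.induct)
  case (2 u e es v)
  then show ?case
    by (cases i; cases es) auto
qed simp

text \<open>Closedness enters only for the last arc, whose successor index wraps around to
  0.\<close>

lemma cas_closed_nth:
  assumes "cas u p u" and "i < length p"
  shows "head G (p ! i) = tail G (p ! (Suc i mod length p))"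
proof (cases "Suc i < length p")
  case True
  then show ?thesis using cas_nth[OF assms(1)] by simp
next
  case False
  then have i: "Suc i = length p" using assms(2) by simp
  obtain q e where q: "p = q @ [e]" using assms(2) by (cases p rule: rev_cases) auto
  have "tail G (p ! 0) = u" using assms by (cases p) auto
  moreover have "head G e = u" using assms(1) q by auto
  ultimately show ?thesis using i q by (simp add: nth_append)
qed

lemma exitless_cycleD:
  assumes "exitless_cycle G p"
  shows "p \<noteq> []" "set p \<subseteq> arcs G" "distinct (map (tail G) p)"
    and "e \<in> set p \<Longrightarrow> out_arcs G (tail G e) = {e}"
    and "i < length p \<Longrightarrow> head G (p ! i) = tail G (p ! (Suc i mod length p))"
proof -
  obtain u where u: "awalk u p u" and *: "p \<noteq> []" "distinct (map (tail G) p)"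
    using assms by (auto simp: exitless_cycle_def cycle_iff_distinct_tails)
  show "p \<noteq> []" "distinct (map (tail G) p)" by fact+
  show arcs: "set p \<subseteq> arcs G" using u by (auto simp: awalk_def)
  show "out_arcs G (tail G e) = {e}" if "e \<in> set p"
    using assms arcs that by (auto simp: exitless_cycle_def has_exit_def)
  show "head G (p ! i) = tail G (p ! (Suc i mod length p))" if "i < length p"
    using cas_closed_nth[OF _ that] u by (auto simp: awalk_def)
qed

text \<open>Without exits, the only arc out of a vertex of the cycle is the one in \<open>p\<close>,
  so \<open>next_vert\<close> walks along the cycle.\<close>

lemma exitless_cycle_next_vert:
  assumes "exitless_cycle G p" and "i < length p"
  shows "(next_vert ^^ k) (tail G (p ! i)) = tail G (p ! ((i + k) mod length p))"
proof (induction k)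
  case 0
  then show ?case using assms by simp
next
  case (Suc k)
  let ?j = "(i + k) mod length p"
  have j: "?j < length p" using assms(2) by (intro mod_less_divisor) linarith
  have "out_arc (tail G (p ! ?j)) = p ! ?j"
    using exitless_cycleD(4)[OF assms(1)] j by (simp add: out_arc_eq)
  then have "next_vert (tail G (p ! ?j)) = tail G (p ! (Suc ?j mod length p))"
    using exitless_cycleD(5)[OF assms(1) j] by (simp add: next_vert_def)
  then show ?case using Suc by (simp add: mod_Suc_eq)
qed

text \<open>Distinct tails make \<open>length p\<close> the first return time. As the right side
  depends on the vertex alone, exitless cycles with a common vertex are rotations of each
  other.\<close>

lemma exitless_cycle_rotate_eq_loop:
  assumes p: "exitless_cycle G p" and i: "i < length p"
  shows "rotate i p = loop (tail G (p ! i))"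
proof -
  let ?v = "tail G (p ! i)" and ?n = "length p"
  have n: "?n > 0" using i by linarith
  have d: "distinct (map (tail G) p)" by (rule exitless_cycleD(3)[OF p])
  have least: "(LEAST n. 0 < n \<and> (next_vert ^^ n) ?v = ?v) = ?n"
  proof (rule Least_equality)
    show "0 < ?n \<and> (next_vert ^^ ?n) ?v = ?v"
      using n i by (simp add: exitless_cycle_next_vert[OF p i])
  next
    fix m assume m: "0 < m \<and> (next_vert ^^ m) ?v = ?v"
    then have "tail G (p ! ((i + m) mod ?n)) = tail G (p ! i)"
      by (simp add: exitless_cycle_next_vert[OF p i])
    then have "(i + m) mod ?n = i"
      using d i n nth_eq_iff_index_eq[OF d, of "(i + m) mod ?n" i] by simp
    then have "(i + m) mod ?n = i mod ?n" using i by simp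
    then have "?n dvd m" by (metis add_diff_cancel_left' le_add1 mod_eq_dvd_iff_nat)
    then show "?n \<le> m" using m by (simp add: dvd_imp_le)
  qed
  show ?thesis
  proof (rule nth_equalityI)
    show "length (rotate i p) = length (loop ?v)" by (simp add: loop_def least)
  next
    fix k assume "k < length (rotate i p)"
    then have k: "k < ?n" by simp
    have "out_arc (tail G (p ! ((i + k) mod ?n))) = p ! ((i + k) mod ?n)"
      using exitless_cycleD(4)[OF p] n by (simp add: out_arc_eq)
    then show "rotate i p ! k = loop ?v ! k"
      using k unfolding loop_def least
      by (simp add: nth_rotate exitless_cycle_next_vert[OF p i] add.commute)
  qed
qed

end

section \<open>Orbits of the successor map\<close>

context fin_digraph
begin

lemma vert_if_out_arc: "e \<in> out_arcs G v \<Longrightarrow> v \<in> verts G"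
  by auto

text \<open>Minimality of the return time makes the vertices of the orbit distinct, and out-degree
  one throughout \<open>T\<close> excludes exits.\<close>

lemma loop_exitless_cycle:
  assumes T: "\<And>u. u \<in> T \<Longrightarrow> \<exists>e. out_arcs G u = {e} \<and> head G e \<in> T"
    and v: "v \<in> T" and n: "n > 0" "(next_vert ^^ n) v = v"
  shows "exitless_cycle G (loop v)" and "v \<in> tail G ` set (loop v)"
proof -
  define L where "L = (LEAST n. 0 < n \<and> (next_vert ^^ n) v = v)"
  have L: "0 < L" "(next_vert ^^ L) v = v"
    using LeastI[of "\<lambda>n. 0 < n \<and> (next_vert ^^ n) v = v" n] n by (auto simp: L_def)
  have L_le: "L \<le> m" if "0 < m" "(next_vert ^^ m) v = v" for m
    unfolding L_def by (rule Least_le) (use that in auto)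
  let ?a = "\<lambda>i. out_arc ((next_vert ^^ i) v)"
  have loop: "loop v = map ?a [0..<L]" by (simp add: loop_def L_def)
  have T1: "out_arcs G u = {out_arc u} \<and> next_vert u \<in> T" if "u \<in> T" for u
    using T[OF that] out_arc_eq next_vert_def by metis
  have inT: "(next_vert ^^ i) v \<in> T" for i
    by (induction i) (use v T1 in auto)
  have arc: "out_arcs G ((next_vert ^^ i) v) = {?a i}" for i
    using T1[OF inT] by blast
  have a: "?a i \<in> arcs G" "tail G (?a i) = (next_vert ^^ i) v" for i
    using arc[of i] by auto
  have hd: "head G (?a i) = (next_vert ^^ Suc i) v" for i
    by (simp add: next_vert_def)
  have vv: "v \<in> verts G" using arc[of 0] vert_if_out_arc[of "?a 0" v] by simp
  have cas: "cas v (map ?a [0..<m]) ((next_vert ^^ m) v)" for m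
  proof (induction m)
    case (Suc m)
    have "[0..<Suc m] = [0..<m] @ [m]" by simp
    then show ?case using cas_snoc[OF Suc a(2)] by (simp only: map_append list.map hd)
  qed simp
  have inj: "i = j" if "i \<le> j" "j < L" "(next_vert ^^ i) v = (next_vert ^^ j) v" for i j
  proof (rule ccontr)
    assume "i \<noteq> j"
    \<comment> \<open>If the orbit agrees at times \<open>i < j\<close>, then \<open>L - j\<close>
      further steps from time \<open>i\<close> already lead to \<open>v\<close>: a return before
      \<open>L\<close>.\<close>
    have "(next_vert ^^ (L - j + i)) v = (next_vert ^^ (L - j)) ((next_vert ^^ j) v)"
      using that(3) by (simp add: funpow_add)
    also have "\<dots> = (next_vert ^^ (L - j + j)) v" by (simp only: funpow_add comp_apply)
    also have "\<dots> = v" using that L by simp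
    finally have "L \<le> L - j + i" using that \<open>i \<noteq> j\<close> by (intro L_le) auto
    then show False using that \<open>i \<noteq> j\<close> by linarith
  qed
  have "inj_on (\<lambda>i. (next_vert ^^ i) v) {0..<L}"
    
  proof (rule inj_onI)
    fix i j assume "i \<in> {0..<L}" "j \<in> {0..<L}" "(next_vert ^^ i) v = (next_vert ^^ j) v"
    then show "i = j" using inj[of i j] inj[of j i] by (cases "i \<le> j") simp_all
  qed
  then have "distinct (map (tail G) (loop v))"
    by (simp only: loop map_map comp_def a(2) distinct_map set_upt distinct_upt simp_thms)
  moreover have "awalk v (loop v) v"
    unfolding awalk_def loop using vv a(1) cas[of L, unfolded L(2)] by (simp add: image_subset_iff)
  moreover have "loop v \<noteq> []" using L by (simp add: loop)
  ultimately have "cycle (loop v)" unfolding cycle_iff_distinct_tails by blast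
  moreover have "\<not> has_exit G (loop v)"
  proof
    assume "has_exit G (loop v)"
    then obtain i f where f: "f \<in> arcs G" "tail G f = tail G (?a i)" "f \<noteq> ?a i"
      unfolding has_exit_def loop set_map by blast
    then have "f \<in> out_arcs G ((next_vert ^^ i) v)" unfolding a(2) by simp
    then show False unfolding arc using f by simp
  qed
  ultimately show "exitless_cycle G (loop v)" by (simp add: exitless_cycle_def)
  have "?a 0 \<in> set (loop v)"
    unfolding loop set_map by (rule imageI) (use L in simp)
  then have "tail G (?a 0) \<in> tail G ` set (loop v)" by (rule imageI)
  then show "v \<in> tail G ` set (loop v)" unfolding a(2) by simp
qed

lemma exitless_verts_next:
  assumes "exitless_cycle G p" and "v \<in> tail G ` set p"
  shows "v \<in> verts G" "out_arcs G v = {out_arc v}" "next_vert v \<in> tail G ` set p"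
proof -
  obtain i where i: "i < length p" "v = tail G (p ! i)"
    using assms(2) by (auto simp: in_set_conv_nth)
  have *: "out_arcs G v = {p ! i}" using exitless_cycleD(4)[OF assms(1)] i by simp
  then show "out_arcs G v = {out_arc v}" using out_arc_eq by metis
  show "v \<in> verts G" using * vert_if_out_arc by blast
  have "Suc i mod length p < length p" using i by (intro mod_less_divisor) linarith
  then show "next_vert v \<in> tail G ` set p"
    using exitless_cycle_next_vert[OF assms(1) i(1), of 1] i by simp
qed

lemma exitless_cycle_hereditary:
  assumes "exitless_cycle G p" and "v \<in> tail G ` set p"
  shows "head G ` out_arcs G v \<subseteq> tail G ` set p"
  using exitless_verts_next[OF assms] by (auto simp: next_vert_def)

lemma exitless_verts_hereditary: "v \<in> exitless_verts \<Longrightarrow> head G ` out_arcs G v \<subseteq> exitless_verts"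
  using exitless_cycle_hereditary unfolding exitless_verts_def by blast

lemma exitless_verts_subset: "exitless_verts \<subseteq> verts G"
  using exitless_verts_next(1) by (auto simp: exitless_verts_def)

text \<open>Heredity carries membership in \<open>H\<close> from \<open>v\<close> along
  \<open>next_vert\<close>, which runs through the whole cycle.\<close>

lemma exitless_cycle_subset_hereditary_saturated:
  assumes p: "exitless_cycle G p" and H: "hereditary_saturated H"
    and v: "v \<in> tail G ` set p" "v \<in> H"
  shows "tail G ` set p \<subseteq> H"
proof
  fix w assume "w \<in> tail G ` set p"
  then obtain j where j: "j < length p" "w = tail G (p ! j)" by (auto simp: in_set_conv_nth)
  obtain i where i: "i < length p" "v = tail G (p ! i)" using v by (auto simp: in_set_conv_nth)
  have "(next_vert ^^ k) v \<in> H \<and> (next_vert ^^ k) v \<in> tail G ` set p" for k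
  proof (induction k)
    case (Suc k)
    let ?w = "(next_vert ^^ k) v"
    note w = exitless_verts_next[OF p conjunct2[OF Suc]]
    have "head G (out_arc ?w) \<in> H"
      by (rule hereditary_saturatedD[OF H conjunct1[OF Suc] w(1)]) (simp add: w(2))
    then show ?case using w(3) by (simp add: next_vert_def[symmetric])
  qed (use v in simp)
  \<comment> \<open>From index \<open>i\<close>, \<open>length p - i\<close> steps lead to index 0
    modulo the length, and \<open>j\<close> more to \<open>w\<close>.\<close>
  then have "(next_vert ^^ (length p - i + j)) v \<in> H" by blast
  then show "w \<in> H" using i j by (simp add: exitless_cycle_next_vert[OF p])
qed

text \<open>On the cycle each defining relation has a single summand, so it moves a letter to the
  next vertex and raises its level by one; a full turn returns to \<open>v\<close>.\<close>

lemma exitless_verts_periodic: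
  assumes "v \<in> exitless_verts"
  shows "\<exists>n>0. talented_cong G {#(v, i)#} {#(v, i + int n)#}"
proof -
  obtain p where p: "exitless_cycle G p" "v \<in> tail G ` set p"
    using assms by (auto simp: exitless_verts_def)
  obtain j where j: "j < length p" "v = tail G (p ! j)" using p by (auto simp: in_set_conv_nth)
  have "talented_cong G {#(v, i)#} {#((next_vert ^^ k) v, i + int k)#} \<and>
      (next_vert ^^ k) v \<in> tail G ` set p" for k
  proof (induction k)
    case 0
    then show ?case using p exitless_verts_next(1)[OF p] by (auto intro: talented_cong.refl)
  next
    case (Suc k)
    let ?w = "(next_vert ^^ k) v"
    note w = exitless_verts_next[OF p(1), of ?w]
    have "talented_cong G {#(?w, i + int k)#} {#(next_vert ?w, i + int k + 1)#}"
      using talented_cong.expand[of ?w G "i + int k"] w Suc by (simp add: next_vert_def)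
    then have "talented_cong G {#(v, i)#} {#(next_vert ?w, i + int k + 1)#}"
      using Suc talented_cong.trans by blast
    then show ?case using Suc w by (simp add: algebra_simps)
  qed
  from this[of "length p"] show ?thesis
    using j exitless_cycleD(1)[OF p(1)] by (intro exI[of _ "length p"]) (simp add: exitless_cycle_next_vert[OF p(1)])
qed

text \<open>By finiteness the orbit of a vertex of \<open>T\<close> repeats, and the repeating part
  is an exitless cycle, hence in \<open>H\<close>; saturation then leads back to the start.\<close>

lemma eventually_periodic_in_hereditary_saturated:
  assumes T: "\<And>u. u \<in> T \<Longrightarrow> \<exists>e. out_arcs G u = {e} \<and> head G e \<in> T"
    and H: "hereditary_saturated H" "exitless_verts \<subseteq> H"
  shows "T \<subseteq> H"
proof
  fix u assume u: "u \<in> T"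
  have T1: "out_arcs G w = {out_arc w} \<and> next_vert w \<in> T" if "w \<in> T" for w
    using T[OF that] out_arc_eq next_vert_def by metis
  have TV: "T \<subseteq> verts G" using T1 vert_if_out_arc by blast
  have inT: "(next_vert ^^ i) u \<in> T" for i
    by (induction i) (use u T1 in auto)
  have "finite (range (\<lambda>i. (next_vert ^^ i) u))"
    by (rule finite_subset[OF _ finite_verts]) (use inT TV in auto)
  then have "\<not> inj (\<lambda>i. (next_vert ^^ i) u)"
    using finite_imageD infinite_UNIV_nat by blast
  then obtain s t where st: "s < t" "(next_vert ^^ s) u = (next_vert ^^ t) u"
    unfolding inj_def by (metis nat_neq_iff)
  let ?x = "(next_vert ^^ s) u"
  have "(next_vert ^^ (t - s)) ?x = (next_vert ^^ (t - s + s)) u"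
    by (simp only: funpow_add comp_apply)
  then have "(next_vert ^^ (t - s)) ?x = ?x" using st by simp
  then have "?x \<in> exitless_verts"
    using loop_exitless_cycle[OF T inT, of "t - s" s] st unfolding exitless_verts_def by auto
  then have "?x \<in> H" using H by blast
  \<comment> \<open>With a single out-arc, saturation needs only the successor in \<open>H\<close>,
    so membership is pulled back one step at a time.\<close>
  moreover have "(next_vert ^^ k) u \<in> H \<Longrightarrow> u \<in> H" for k
  proof (induction k)
    case (Suc k)
    let ?w = "(next_vert ^^ k) u"
    have w: "out_arcs G ?w = {out_arc ?w}" "?w \<in> verts G" using T1 inT TV by blast+
    then have "?w \<in> H \<longleftrightarrow> head G ` {out_arc ?w} \<subseteq> H"
      using H(1) unfolding hereditary_saturated_def by (metis insert_not_empty)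
    then have "?w \<in> H" using Suc.prems by (simp add: next_vert_def[symmetric])
    then show ?case by (rule Suc.IH)
  qed simp
  ultimately show "u \<in> H" by blast
qed

text \<open>From some round on, periodicity forbids sinks and growth in the unfoldings of
  \<open>v\<close>, so all out-degrees there are one and the preceding lemma applies to the
  occurring vertices.\<close>

lemma periodic_in_hereditary_saturated:
  assumes v: "v \<in> verts G" and n: "n \<noteq> 0" and c: "talented_cong G {#(v, 0)#} {#(v, n)#}"
    and H: "hereditary_saturated H" "exitless_verts \<subseteq> H"
  shows "v \<in> H"
proof -
  \<comment> \<open>A negative period becomes positive by shifting the congruence by
    \<open>- n\<close> and reversing it.\<close>
  have "\<exists>m>0. talented_cong G {#(v, 0)#} {#(v, int m)#}"
  proof (cases "n > 0")
    case True
    then show ?thesis using c by (intro exI[of _ "nat n"]) simp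
  next
    case False
    have "talented_cong G {#(v, - n)#} {#(v, 0)#}"
      using talented_cong_shift[OF c, of "- n"] by simp
    then show ?thesis using False n
      by (intro exI[of _ "nat (- n)"]) (auto intro: talented_cong.sym)
  qed
  then obtain m where m: "m > 0" and cm: "talented_cong G {#(v, 0)#} {#(v, int m)#}" by blast
  obtain n0 where n0: "\<And>k. k \<ge> n0 \<Longrightarrow> normal k {#(v, 0)#} = normal k {#(v, int m)#}"
    using normal_cong[OF cm] by blast
  define K where "K = nat n0"
  let ?a = "\<lambda>k. unfold k v 0"
  \<comment> \<open>In the normal forms at level \<open>k + m\<close>, \<open>v(0)\<close> has been
    unfolded \<open>k + m\<close> rounds but \<open>v(m)\<close> only \<open>k\<close>.\<close>
  have per: "?a (k + m) = shift_word (int m) (?a k)" if "k \<ge> K" for k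
  proof -
    have "nat (int k + int m) = k + m" by simp
    then show ?thesis using n0[of "int (k + m)"] that by (simp add: K_def shift_word_unfold)
  qed
  have per': "?a (k + t * m) = shift_word (int (t * m)) (?a k)" if "k \<ge> K" for k t
  proof (induction t)
    case (Suc t)
    have "?a (k + Suc t * m) = ?a ((k + t * m) + m)" by (simp add: algebra_simps)
    also have "\<dots> = shift_word (int m) (?a (k + t * m))" using that by (intro per) simp
    also have "\<dots> = shift_word (int (Suc t * m)) (?a k)"
      unfolding Suc.IH by (simp add: algebra_simps)
    finally show ?case .
  qed simp
  \<comment> \<open>A sink never moves, so the shifts by \<open>t * m\<close> would push it below level \<open>0\<close>.\<close>
  have no_sink: "out_arcs G w \<noteq> {}" if w: "(w, j) \<in># ?a k" and k: "k \<ge> K" for w j k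
  proof
    assume e: "out_arcs G w = {}"
    define t where "t = nat j + 1"
    have "(w, j) \<in># ?a (k + t * m)"
      unfolding unfold_plus using w e by (auto simp: unfold_sink intro!: bexI[of _ "(w, j)"])
    then have "(w, j) \<in># shift_word (int (t * m)) (?a k)" using per'[OF k] by simp
    then have "(w, j - int (t * m)) \<in># ?a k" by (auto simp: shift_word_def)
    then have "0 \<le> j - int (t * m)" by (rule unfold_level)
    moreover have "int t \<le> int (t * m)" using m by (simp only: of_nat_le_iff) simp
    moreover have "j < int t" by (simp add: t_def)
    ultimately show False by linarith
  qed
  \<comment> \<open>In the absence of sinks a round replaces each letter by as many letters as its
    out-degree, hence by at least one.\<close>
  have mono1: "size (?a k) \<le> size (?a (Suc k))" and
    step: "size (?a (Suc k)) = (\<Sum>(w, j)\<in>#?a k. card (out_arcs G w))" if k: "k \<ge> K" for k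
  proof -
    have "size (unfold 1 w j) = card (out_arcs G w)" if "(w, j) \<in># ?a k" for w j
      using no_sink[OF that k] by (simp add: size_multiset_sum)
    then have "image_mset (\<lambda>(w, j). size (unfold 1 w j)) (?a k) =
        image_mset (\<lambda>(w, j). card (out_arcs G w)) (?a k)"
      by (intro image_mset_cong) auto
    moreover have "size (?a (k + 1)) = (\<Sum>(w, j)\<in>#?a k. size (unfold 1 w j))"
      unfolding unfold_plus size_mset_sum_mset_conv
      by (simp only: multiset.map_comp comp_def split_def)
    ultimately show st: "size (?a (Suc k)) = (\<Sum>(w, j)\<in>#?a k. card (out_arcs G w))" by simp
    have "(\<Sum>x\<in>#?a k. 1) \<le> (\<Sum>(w, j)\<in>#?a k. card (out_arcs G w))"
      using no_sink[OF _ k] by (intro sum_mset_mono) (auto simp: Suc_le_eq card_gt_0_iff)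
    then show "size (?a k) \<le> size (?a (Suc k))" unfolding st by simp
  qed
  have mono: "size (?a k) \<le> size (?a (k + d))" if "k \<ge> K" for k d
  proof (induction d)
    case (Suc d)
    have "size (?a (k + d)) \<le> size (?a (Suc (k + d)))" using that by (intro mono1) simp
    then show ?case unfolding add_Suc_right by (rule order_trans[OF Suc])
  qed simp
  have const: "size (?a (Suc k)) = size (?a k)" if "k \<ge> K" for k
  proof -
    \<comment> \<open>The round \<open>Suc k\<close> lies within a period of \<open>m\<close>
      rounds, after which the size is the same again, shifts being harmless.\<close>
    have "size (?a (Suc k)) \<le> size (?a (Suc k + (m - 1)))" using that by (intro mono) simp
    also have "\<dots> = size (?a k)" using m per[OF that] by simp
    finally show ?thesis using mono1[OF that] by simp
  qed
  have one: "card (out_arcs G w) = 1" if w: "(w, j) \<in># ?a k" and k: "k \<ge> K" for w j k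
  proof -
    \<comment> \<open>The out-degrees are at least one and sum to the number of letters.\<close>
    have "(\<lambda>(w, j). card (out_arcs G w)) (w, j) = (\<lambda>_. 1) (w, j)"
      by (rule sum_mset_le_eqD[OF _ _ w])
        (use no_sink[OF _ k] step[OF k] const[OF k] in
          \<open>auto simp: Suc_le_eq card_gt_0_iff\<close>)
    then show ?thesis by simp
  qed
  \<comment> \<open>The vertices occurring from round \<open>K\<close> on; the head of an arc
    leaving one of them occurs a round later.\<close>
  define T where "T = (\<Union>k\<in>{K..}. descendants k v)"
  have "T \<subseteq> H"
  proof (rule eventually_periodic_in_hereditary_saturated[OF _ H])
    fix u assume "u \<in> T"
    then obtain k j where k: "k \<ge> K" and u: "(u, j) \<in># ?a k"
      by (auto simp: T_def descendants_def)
    obtain e where e: "out_arcs G u = {e}" using one[OF u k] by (auto simp: card_1_singleton_iff)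
    have "(head G e, j + 1) \<in># ?a (k + 1)"
      unfolding unfold_plus using u e by (force intro!: bexI[of _ "(u, j)"])
    then have "head G e \<in> descendants (k + 1) v" unfolding descendants_def by (rule image_eqI[rotated]) simp
    then have "head G e \<in> T" unfolding T_def by (rule UN_I[rotated]) (use k in simp)
    then show "\<exists>e. out_arcs G u = {e} \<and> head G e \<in> T" using e by blast
  qed
  \<comment> \<open>All descendants at round \<open>K\<close> lie in \<open>H\<close>, and
    \<open>v\<close> is congruent to its unfolding.\<close>
  then have "descendants K v \<subseteq> H" by (auto simp: T_def)
  then show ?thesis using descendants_hereditary_saturated[OF v H(1)] by blast
qed

end

section \<open>Order ideals of the talented monoid\<close>

lemma equiv_rotation_rel: "equiv UNIV (rotation_rel :: 'e list rel)"
proof (rule equivI)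
  show "refl (rotation_rel :: 'e list rel)"
    by (auto simp: refl_on_def rotation_rel_def intro: exI[of _ 0])
  show "sym (rotation_rel :: 'e list rel)"
  proof (rule symI)
    fix p q :: "'e list" assume "(p, q) \<in> rotation_rel"
    then obtain k where q: "q = rotate k p" by (auto simp: rotation_rel_def)
    \<comment> \<open>Together with the first \<open>k\<close> places this rotates by
      \<open>k * length p\<close>, a multiple of the length; the empty list is treated
      apart.\<close>
    have "rotate (k * (length p - 1)) q = rotate (k * (length p - 1) + k) p"
      unfolding q rotate_rotate ..
    also have "\<dots> = p"
    proof (cases p)
      case (Cons e es)
      then have "k * (length p - 1) + k = k * length p" by (simp add: algebra_simps)
      then show ?thesis by (simp add: rotate_id)
    qed simp
    finally have "p = rotate (k * (length p - 1)) q" by (rule HOL.sym)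
    then show "(q, p) \<in> rotation_rel"
      unfolding rotation_rel_def mem_Collect_eq prod.case by (rule exI)
  qed
  show "trans (rotation_rel :: 'e list rel)"
    by (rule transI) (auto simp: rotation_rel_def rotate_rotate)
qed (auto simp: rotation_rel_def)

context fin_digraph
begin

abbreviation word_class :: "('a \<times> int) multiset \<Rightarrow> ('a \<times> int) multiset set" where
  "word_class x \<equiv> talented_rel G `` {x}"

text \<open>With \<open>ideal_verts\<close> this gives the correspondence between hereditary
  saturated sets of vertices and order ideals.\<close>

definition ideal_of :: "'a set \<Rightarrow> ('a \<times> int) multiset set set" where
  "ideal_of H = {word_class x | x. x \<in> talented_words G \<and> fst ` set_mset x \<subseteq> H}"

definition ideal_verts :: "('a \<times> int) multiset set set \<Rightarrow> 'a set" where
  "ideal_verts I = {v \<in> verts G. vertex_class G v \<in> I}"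

lemma carrier_talented_monoid: "carrier (talented_monoid G) = word_class ` talented_words G"
  by (auto simp: talented_monoid_def quotient_def)

lemma one_talented_monoid: "\<one>\<^bsub>talented_monoid G\<^esub> = word_class {#}"
  by (simp add: talented_monoid_def)

lemma word_class_eq_iff:
  "x \<in> talented_words G \<Longrightarrow> y \<in> talented_words G \<Longrightarrow>
   word_class x = word_class y \<longleftrightarrow> talented_cong G x y"
  using eq_equiv_class_iff[OF equiv_talented_rel] by (simp add: talented_rel_def)

lemma word_class_cong: "talented_cong G x y \<Longrightarrow> word_class x = word_class y"
  using word_class_eq_iff talented_cong_words by blast

text \<open>Congruence preserves support in \<open>H\<close>, so membership can be tested on any
  representative.\<close>

lemma word_class_in_ideal_of:
  assumes "x \<in> talented_words G" "hereditary_saturated H"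
  shows "word_class x \<in> ideal_of H \<longleftrightarrow> fst ` set_mset x \<subseteq> H"
proof
  assume "word_class x \<in> ideal_of H"
  then obtain y where "talented_cong G x y" "fst ` set_mset y \<subseteq> H"
    using assms(1) word_class_eq_iff unfolding ideal_of_def by blast
  then show "fst ` set_mset x \<subseteq> H"
    using talented_cong_hereditary_saturated assms(2) by blast
qed (use assms in \<open>auto simp: ideal_of_def\<close>)

text \<open>The support of a sum is the union of the supports, which yields closure under sums and
  under summands alike; shifts do not change the vertices.\<close>

lemma Z_order_ideal_ideal_of:
  assumes H: "hereditary_saturated H"
  shows "Z_order_ideal (talented_monoid G) (ideal_of H)"
  unfolding Z_order_ideal_def
proof (intro conjI allI ballI impI)
  show "submonoid (ideal_of H) (talented_monoid G)"
  proof
    show "ideal_of H \<subseteq> carrier (talented_monoid G)"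
      by (auto simp: ideal_of_def carrier_talented_monoid)
  next
    fix x y assume "x \<in> ideal_of H" "y \<in> ideal_of H"
    then obtain a b where *: "x = word_class a" "y = word_class b"
      "a \<in> talented_words G" "b \<in> talented_words G"
      "fst ` set_mset a \<subseteq> H" "fst ` set_mset b \<subseteq> H"
      by (auto simp: ideal_of_def)
    then have "word_class (a + b) \<in> ideal_of H"
      by (subst word_class_in_ideal_of[OF _ H]) auto
    then show "x \<otimes>\<^bsub>talented_monoid G\<^esub> y \<in> ideal_of H"
      using * by (simp add: talented_class_mult)
  next
    show "\<one>\<^bsub>talented_monoid G\<^esub> \<in> ideal_of H"
      by (simp add: one_talented_monoid word_class_in_ideal_of[OF _ H])
  qed
next
  fix n x assume "x \<in> ideal_of H"
  then obtain a where *: "x = word_class a" "a \<in> talented_words G" "fst ` set_mset a \<subseteq> H"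
    by (auto simp: ideal_of_def)
  then show "act (talented_monoid G) n x \<in> ideal_of H"
    by (simp add: talented_class_act word_class_in_ideal_of[OF _ H])
next
  fix x y assume xy: "x \<in> carrier (talented_monoid G)" "y \<in> carrier (talented_monoid G)"
    "x \<otimes>\<^bsub>talented_monoid G\<^esub> y \<in> ideal_of H"
  obtain a b where *: "x = word_class a" "y = word_class b"
    "a \<in> talented_words G" "b \<in> talented_words G"
    using xy by (auto simp: carrier_talented_monoid)
  then have "word_class (a + b) \<in> ideal_of H" using xy by (simp add: talented_class_mult)
  then have "fst ` set_mset (a + b) \<subseteq> H" using * word_class_in_ideal_of[OF _ H] by simp
  then show "x \<in> ideal_of H" "y \<in> ideal_of H"
    using * by (auto simp: ideal_of_def)
qed

text \<open>The order ideal property breaks a word into its letters, and the action moves each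
  letter to level 0, so the vertices in \<open>I\<close> determine \<open>I\<close>.\<close>

lemma Z_order_ideal_word_class_iff:
  assumes I: "Z_order_ideal (talented_monoid G) I" and x: "x \<in> talented_words G"
  shows "word_class x \<in> I \<longleftrightarrow> fst ` set_mset x \<subseteq> ideal_verts I"
  using x
proof (induction x)
  case empty
  have "submonoid I (talented_monoid G)" using I by (simp add: Z_order_ideal_def)
  then show ?case using submonoid.one_closed one_talented_monoid by fastforce
next
  case (add a x)
  obtain v i where a: "a = (v, i)" by (cases a)
  have w: "v \<in> verts G" "x \<in> talented_words G"
    using add.prems a by (auto simp: talented_words_def)
  have act: "act (talented_monoid G) n y \<in> I" if "y \<in> I" for n y
    using I that by (simp add: Z_order_ideal_def)
  have "word_class {#(v, i)#} \<in> I \<longleftrightarrow> v \<in> ideal_verts I"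
  proof
    assume "word_class {#(v, i)#} \<in> I"
    from act[OF this, of "- i"] show "v \<in> ideal_verts I"
      using w by (simp add: talented_class_act ideal_verts_def vertex_class_def)
  next
    assume "v \<in> ideal_verts I"
    then have "word_class {#(v, 0)#} \<in> I" by (simp add: ideal_verts_def vertex_class_def)
    from act[OF this, of i] show "word_class {#(v, i)#} \<in> I"
      using w by (simp add: talented_class_act)
  qed
  moreover have "word_class (add_mset a x) \<in> I \<longleftrightarrow> word_class {#(v, i)#} \<in> I \<and> word_class x \<in> I"
  proof -
    have *: "word_class (add_mset a x) =
        word_class {#(v, i)#} \<otimes>\<^bsub>talented_monoid G\<^esub> word_class x"
      using w a by (simp add: talented_class_mult)
    have "submonoid I (talented_monoid G)" using I by (simp add: Z_order_ideal_def)
    moreover have "word_class {#(v, i)#} \<in> carrier (talented_monoid G)"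
      "word_class x \<in> carrier (talented_monoid G)"
      using w by (auto simp: carrier_talented_monoid)
    ultimately show ?thesis
      unfolding * using I submonoid.m_closed unfolding Z_order_ideal_def by metis
  qed
  ultimately show ?case using add.IH w a by simp
qed

lemma ideal_of_ideal_verts:
  assumes I: "Z_order_ideal (talented_monoid G) I"
  shows "ideal_of (ideal_verts I) = I"
proof -
  have "I \<subseteq> carrier (talented_monoid G)"
    using I submonoid.subset unfolding Z_order_ideal_def by blast
  then have "c \<in> I \<longleftrightarrow> (\<exists>x. c = word_class x \<and> x \<in> talented_words G \<and> word_class x \<in> I)" for c
    unfolding carrier_talented_monoid by blast
  then have "c \<in> I \<longleftrightarrow> c \<in> ideal_of (ideal_verts I)" for c
    unfolding ideal_of_def mem_Collect_eq using Z_order_ideal_word_class_iff[OF I] by metis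
  then show ?thesis by blast
qed

text \<open>The two sides of a defining relation are the same element, and the preceding criterion
  reads off its membership from either.\<close>

lemma hereditary_saturated_ideal_verts:
  assumes I: "Z_order_ideal (talented_monoid G) I"
  shows "hereditary_saturated (ideal_verts I)"
  unfolding hereditary_saturated_def
proof (intro ballI impI)
  fix v assume v: "v \<in> verts G" "out_arcs G v \<noteq> {}"
  note c = talented_cong.expand[OF v, of 0]
  have "word_class {#(v, 0)#} \<in> I \<longleftrightarrow>
      word_class (\<Sum>e\<in>out_arcs G v. {#(head G e, 0 + 1)#}) \<in> I"
    using word_class_cong[OF c] by simp
  moreover have "fst ` set_mset (\<Sum>e\<in>out_arcs G v. {#(head G e, 0 + 1 :: int)#}) =
      head G ` out_arcs G v"
    by (auto simp: set_mset_sum image_UN)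
  ultimately show "v \<in> ideal_verts I \<longleftrightarrow> head G ` out_arcs G v \<subseteq> ideal_verts I"
    using talented_cong_words[OF c] by (simp add: Z_order_ideal_word_class_iff[OF I])
qed

text \<open>Words only see the elements of \<open>H\<close> that are vertices, whence the
  intersection.\<close>

lemma ideal_of_subset_iff:
  assumes "hereditary_saturated H'"
  shows "ideal_of H \<subseteq> ideal_of H' \<longleftrightarrow> H \<inter> verts G \<subseteq> H'"
proof
  assume le: "ideal_of H \<subseteq> ideal_of H'"
  show "H \<inter> verts G \<subseteq> H'"
  proof
    fix v assume v: "v \<in> H \<inter> verts G"
    then have "word_class {#(v, 0)#} \<in> ideal_of H"
      unfolding ideal_of_def by (intro CollectI exI[of _ "{#(v, 0)#}"]) auto
    then show "v \<in> H'" using v le word_class_in_ideal_of[OF _ assms, of "{#(v, 0)#}"] by auto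
  qed
next
  assume le: "H \<inter> verts G \<subseteq> H'"
  then have "fst ` set_mset x \<subseteq> H'" if "x \<in> talented_words G" "fst ` set_mset x \<subseteq> H" for x
    using that by (force simp: talented_words_def)
  then show "ideal_of H \<subseteq> ideal_of H'" unfolding ideal_of_def by blast
qed

section \<open>The zero ideal and generated ideals\<close>

lemma ideal_of_empty: "ideal_of {} = {\<one>\<^bsub>talented_monoid G\<^esub>}"
  by (auto simp: ideal_of_def one_talented_monoid)

lemma hereditary_saturated_empty: "hereditary_saturated {}"
  by (simp add: hereditary_saturated_def)

lemma ideal_of_eq_one_iff: "ideal_of H = {\<one>\<^bsub>talented_monoid G\<^esub>} \<longleftrightarrow> H \<inter> verts G = {}"
proof -
  have "ideal_of {} \<subseteq> ideal_of H" unfolding ideal_of_def by blast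
  then show ?thesis
    unfolding ideal_of_empty[symmetric] set_eq_subset[of "ideal_of H"]
      ideal_of_subset_iff[OF hereditary_saturated_empty] by (simp only: subset_empty simp_thms)
qed

text \<open>The correspondence respects inclusion, so it matches the least ideal with the least
  hereditary saturated set.\<close>

lemma generated_Z_order_ideal_eq:
  assumes X: "X \<subseteq> verts G"
  shows "generated_Z_order_ideal (talented_monoid G) (vertex_class G ` X) =
    ideal_of (hereditary_saturated hull X)"
  unfolding generated_Z_order_ideal_def
proof (rule hull_unique)
  show "vertex_class G ` X \<subseteq> ideal_of (hereditary_saturated hull X)"
  proof
    fix c assume "c \<in> vertex_class G ` X"
    then obtain v where "c = word_class {#(v, 0)#}" "v \<in> X" by (auto simp: vertex_class_def)
    then show "c \<in> ideal_of (hereditary_saturated hull X)"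
      using X by (simp add: word_class_in_ideal_of[OF _ hereditary_saturated_hull] hull_inc subsetD)
  qed
  show "Z_order_ideal (talented_monoid G) (ideal_of (hereditary_saturated hull X))"
    by (rule Z_order_ideal_ideal_of[OF hereditary_saturated_hull])
next
  fix I assume I: "vertex_class G ` X \<subseteq> I" "Z_order_ideal (talented_monoid G) I"
  have "hereditary_saturated hull X \<subseteq> ideal_verts I"
    by (rule hull_minimal[where S = hereditary_saturated, OF _ hereditary_saturated_ideal_verts[OF I(2)]])
      (use I X in \<open>auto simp: ideal_verts_def\<close>)
  then have "ideal_of (hereditary_saturated hull X) \<subseteq> ideal_of (ideal_verts I)"
    using ideal_of_subset_iff[OF hereditary_saturated_ideal_verts[OF I(2)]] by blast
  then show "ideal_of (hereditary_saturated hull X) \<subseteq> I"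
    by (simp add: ideal_of_ideal_verts[OF I(2)])
qed

text \<open>The explicit saturation of \<open>X\<close> contains \<open>X\<close>, by
  \<open>k = 0\<close>, and hence the hull.\<close>

lemma hull_descendants:
  assumes "\<And>v. v \<in> X \<Longrightarrow> head G ` out_arcs G v \<subseteq> X" and "v \<in> hereditary_saturated hull X"
  shows "\<exists>k. descendants k v \<subseteq> X"
proof -
  have "X \<subseteq> {v. \<exists>k. descendants k v \<subseteq> X}"
    by (intro subsetI CollectI exI[of _ 0]) simp
  then have "hereditary_saturated hull X \<subseteq> {v. \<exists>k. descendants k v \<subseteq> X}"
    by (rule hull_minimal[where S = hereditary_saturated, OF _ hereditary_saturated_descendants[OF assms(1)]])
  then show ?thesis using assms(2) by blast
qed

text \<open>The descendants of \<open>v\<close> end up in \<open>X\<close>, never leave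
  \<open>H\<close> and do not die out.\<close>

lemma hull_meets:
  assumes X: "\<And>v. v \<in> X \<Longrightarrow> head G ` out_arcs G v \<subseteq> X"
    and v: "v \<in> hereditary_saturated hull X" "v \<in> H" "v \<in> verts G"
    and H: "hereditary_saturated H"
  shows "X \<inter> H \<noteq> {}"
proof -
  obtain k where "descendants k v \<subseteq> X" using hull_descendants[OF X v(1)] by blast
  moreover have "descendants k v \<subseteq> H" using descendants_hereditary_saturated[OF v(3) H] v(2) by blast
  ultimately show ?thesis using descendants_nonempty[of k v] by blast
qed

text \<open>Each letter is unfolded, by its own number of rounds, until it lands in
  \<open>X\<close>.\<close>

lemma word_in_hull_cong:
  assumes X: "\<And>v. v \<in> X \<Longrightarrow> head G ` out_arcs G v \<subseteq> X"
    and x: "x \<in> talented_words G" "fst ` set_mset x \<subseteq> hereditary_saturated hull X"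
  shows "\<exists>y. talented_cong G x y \<and> fst ` set_mset y \<subseteq> X"
  using x
proof (induction x)
  case empty
  have "talented_cong G {#} {#}" by (rule talented_cong.refl) simp
  then show ?case by (intro exI[of _ "{#}"]) simp
next
  case (add a x)
  obtain v i where a: "a = (v, i)" by (cases a)
  have w: "v \<in> verts G" "x \<in> talented_words G"
    using add.prems a by (auto simp: talented_words_def)
  have h: "v \<in> hereditary_saturated hull X" "fst ` set_mset x \<subseteq> hereditary_saturated hull X"
    using add.prems(2) a by simp_all
  obtain y where y: "talented_cong G x y" "fst ` set_mset y \<subseteq> X" using add.IH[OF w(2) h(2)] by blast
  obtain k where k: "descendants k v \<subseteq> X" using hull_descendants[OF X h(1)] by blast
  have "talented_cong G ({#(v, i)#} + x) (unfold k v i + y)"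
    by (rule talented_cong.add[OF talented_cong_unfold[OF w(1)] y(1)])
  moreover have "fst ` set_mset (unfold k v i + y) \<subseteq> X"
    using k y unfolding set_mset_union image_Un fst_set_unfold by blast
  moreover have "add_mset a x = {#(v, i)#} + x" using a by simp
  ultimately show ?case by metis
qed

section \<open>Periodic words and cyclic ideals\<close>

lemma talented_cong_shift_iterate:
  assumes "talented_cong G x (shift_word n x)" and "x \<in> talented_words G"
  shows "talented_cong G x (shift_word (int t * n) x)"
proof (induction t)
  case (Suc t)
  have "talented_cong G (shift_word (int t * n) x) (shift_word (int t * n + n) x)"
    using talented_cong_shift[OF assms(1), of "int t * n"] by simp
  then show ?case using talented_cong.trans[OF Suc] by (simp add: algebra_simps)
qed (use assms in \<open>simp add: talented_cong.refl\<close>)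

text \<open>The letters have individual periods; their product is a common one.\<close>

lemma exitless_word_periodic:
  assumes "fst ` set_mset x \<subseteq> exitless_verts"
  shows "\<exists>n>0. talented_cong G x (shift_word (int n) x)"
  using assms
proof (induction x)
  case empty
  then show ?case by (auto intro: exI[of _ 1] talented_cong.refl)
next
  case (add a x)
  obtain v i where a: "a = (v, i)" by (cases a)
  have v: "v \<in> exitless_verts" using add.prems a by simp
  have vv: "{#(v, i)#} \<in> talented_words G" using v exitless_verts_subset by auto
  obtain n where n: "n > 0" "talented_cong G x (shift_word (int n) x)" using add by auto
  obtain m where m: "m > 0" "talented_cong G {#(v, i)#} (shift_word (int m) {#(v, i)#})"
    using exitless_verts_periodic[OF v, of i] by auto
  have "talented_cong G ({#(v, i)#} + x)
      (shift_word (int n * int m) {#(v, i)#} + shift_word (int m * int n) x)"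
    by (intro talented_cong.add talented_cong_shift_iterate n m vv
        conjunct1[OF talented_cong_words[OF n(2)]])
  then have "talented_cong G (add_mset a x) (shift_word (int (n * m)) (add_mset a x))"
    using shift_word_simps(2)[of "int n * int m" "{#(v, i)#}" x] a by (simp add: mult.commute)
  then show ?case using n m by (intro exI[of _ "n * m"]) simp
qed

text \<open>Every class in the ideal has a representative over \<open>exitless_verts\<close>, and
  such words are periodic.\<close>

lemma cyclic_Z_order_ideal_of:
  assumes H: "hereditary_saturated H" "H \<subseteq> hereditary_saturated hull exitless_verts"
  shows "cyclic_Z_order_ideal (talented_monoid G) (ideal_of H)"
  unfolding cyclic_Z_order_ideal_def
proof (intro conjI ballI)
  show "Z_order_ideal (talented_monoid G) (ideal_of H)" by (rule Z_order_ideal_ideal_of[OF H(1)])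
  fix c assume "c \<in> ideal_of H"
  then obtain x where x: "c = word_class x" "x \<in> talented_words G" "fst ` set_mset x \<subseteq> H"
    by (auto simp: ideal_of_def)
  obtain y where y: "talented_cong G x y" "fst ` set_mset y \<subseteq> exitless_verts"
    using word_in_hull_cong[OF exitless_verts_hereditary x(2)] x(3) H(2) by blast
  obtain n where n: "n > 0" "talented_cong G y (shift_word (int n) y)"
    using exitless_word_periodic[OF y(2)] by blast
  have "c = word_class y" using x(1) word_class_cong[OF y(1)] by simp
  moreover have "act (talented_monoid G) (int n) (word_class y) = word_class y"
    unfolding word_class_cong[OF n(2), symmetric]
      talented_class_act[OF conjunct1[OF talented_cong_words[OF n(2)]]] ..
  ultimately show "\<exists>n. n \<noteq> 0 \<and> act (talented_monoid G) n c = c"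
    using n(1) by (intro exI[of _ "int n"]) simp
qed

lemma cyclic_Z_order_ideal_verts:
  assumes I: "cyclic_Z_order_ideal (talented_monoid G) I"
  shows "ideal_verts I \<subseteq> hereditary_saturated hull exitless_verts"
proof
  fix v assume "v \<in> ideal_verts I"
  then have v: "v \<in> verts G" "word_class {#(v, 0)#} \<in> I"
    by (auto simp: ideal_verts_def vertex_class_def)
  obtain n where n: "n \<noteq> 0" "act (talented_monoid G) n (word_class {#(v, 0)#}) = word_class {#(v, 0)#}"
    using I v(2) by (auto simp: cyclic_Z_order_ideal_def)
  have "talented_cong G {#(v, n)#} {#(v, 0)#}"
    using n(2) v word_class_eq_iff[of "{#(v, n)#}" "{#(v, 0)#}"] by (simp add: talented_class_act)
  then show "v \<in> hereditary_saturated hull exitless_verts"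
    by (rule periodic_in_hereditary_saturated[OF v(1) n(1) talented_cong.sym
          hereditary_saturated_hull hull_subset])
qed

section \<open>The ideals of single cycles and their minimality\<close>

definition cycle_ideal :: "'b list \<Rightarrow> ('a \<times> int) multiset set set" where
  "cycle_ideal p = ideal_of (hereditary_saturated hull (tail G ` set p))"

lemma exitless_cycle_tails_subset: "exitless_cycle G p \<Longrightarrow> tail G ` set p \<subseteq> exitless_verts"
  by (auto simp: exitless_verts_def)

lemma cycle_ideal_not_one:
  assumes "exitless_cycle G p"
  shows "cycle_ideal p \<noteq> {\<one>\<^bsub>talented_monoid G\<^esub>}"
proof -
  obtain v where v: "v \<in> tail G ` set p" using exitless_cycleD(1)[OF assms] by (cases p) auto
  have "v \<in> verts G" by (rule exitless_verts_next(1)[OF assms v])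
  moreover have "v \<in> hereditary_saturated hull (tail G ` set p)" by (rule hull_inc[OF v])
  ultimately have "hereditary_saturated hull (tail G ` set p) \<inter> verts G \<noteq> {}" by (metis IntI empty_iff)
  then show ?thesis unfolding cycle_ideal_def ideal_of_eq_one_iff .
qed

text \<open>One common vertex suffices, since heredity spreads it over the whole cycle.\<close>

lemma cycle_ideal_subset:
  assumes p: "exitless_cycle G p" and I: "Z_order_ideal (talented_monoid G) I"
    and v: "v \<in> tail G ` set p" "v \<in> ideal_verts I"
  shows "cycle_ideal p \<subseteq> I"
proof -
  note hs = hereditary_saturated_ideal_verts[OF I]
  have "hereditary_saturated hull (tail G ` set p) \<subseteq> ideal_verts I"
    by (rule hull_minimal[where S = hereditary_saturated, OF exitless_cycle_subset_hereditary_saturated[OF p hs v] hs])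
  then have "cycle_ideal p \<subseteq> ideal_of (ideal_verts I)"
    unfolding cycle_ideal_def ideal_of_subset_iff[OF hs] by (rule le_infI1)
  then show ?thesis unfolding ideal_of_ideal_verts[OF I] .
qed

lemma ideal_verts_nonempty:
  assumes "Z_order_ideal (talented_monoid G) I" "I \<noteq> {\<one>\<^bsub>talented_monoid G\<^esub>}"
  shows "ideal_verts I \<noteq> {}"
  using assms ideal_of_ideal_verts ideal_of_empty by metis

lemma cyclic_cycle_ideal:
  assumes p: "exitless_cycle G p"
  shows "cyclic_Z_order_ideal (talented_monoid G) (cycle_ideal p)"
  unfolding cycle_ideal_def
  by (rule cyclic_Z_order_ideal_of[OF hereditary_saturated_hull
        hull_mono[OF exitless_cycle_tails_subset[OF p]]])

text \<open>A vertex of a non-zero \<open>J\<close> inside the ideal has descendants on the cycle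
  that are still in \<open>J\<close>, so \<open>J\<close> contains the generators.\<close>

lemma minimal_cycle_ideal:
  assumes p: "exitless_cycle G p"
  shows "minimal_Z_order_ideal (talented_monoid G) (cycle_ideal p)"
  unfolding minimal_Z_order_ideal_def
proof (intro conjI allI impI)
  show "Z_order_ideal (talented_monoid G) (cycle_ideal p)"
    using cyclic_cycle_ideal[OF p] by (simp add: cyclic_Z_order_ideal_def)
  show "cycle_ideal p \<noteq> {\<one>\<^bsub>talented_monoid G\<^esub>}" by (rule cycle_ideal_not_one[OF p])
  fix J assume J: "Z_order_ideal (talented_monoid G) J \<and> J \<noteq> {\<one>\<^bsub>talented_monoid G\<^esub>} \<and> J \<subseteq> cycle_ideal p"
  note hs = hereditary_saturated_ideal_verts[of J]
  obtain v where v: "v \<in> ideal_verts J" using ideal_verts_nonempty J by blast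
  have "ideal_of (ideal_verts J) \<subseteq> cycle_ideal p" using J ideal_of_ideal_verts by simp
  then have "ideal_verts J \<inter> verts G \<subseteq> hereditary_saturated hull (tail G ` set p)"
    unfolding cycle_ideal_def by (simp only: ideal_of_subset_iff[OF hereditary_saturated_hull])
  then have "tail G ` set p \<inter> ideal_verts J \<noteq> {}"
    using v J hull_meets[OF exitless_cycle_hereditary[OF p] _ v _ hs]
    unfolding ideal_verts_def by blast
  then show "J = cycle_ideal p" using cycle_ideal_subset[OF p] J by blast
qed

text \<open>A non-zero cyclic ideal has a vertex in the hull of \<open>exitless_verts\<close>, so it
  meets an exitless cycle and contains the ideal of that cycle; minimality gives equality.\<close>

lemma cyclic_minimal_Z_order_ideals:
  "{I. cyclic_Z_order_ideal (talented_monoid G) I \<and> minimal_Z_order_ideal (talented_monoid G) I}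
   = cycle_ideal ` {p. exitless_cycle G p}"
proof (intro equalityI subsetI)
  fix I assume "I \<in> {I. cyclic_Z_order_ideal (talented_monoid G) I \<and>
      minimal_Z_order_ideal (talented_monoid G) I}"
  then have c: "cyclic_Z_order_ideal (talented_monoid G) I"
    and m: "minimal_Z_order_ideal (talented_monoid G) I" by auto
  have I: "Z_order_ideal (talented_monoid G) I" using c by (simp add: cyclic_Z_order_ideal_def)
  have "I \<noteq> {\<one>\<^bsub>talented_monoid G\<^esub>}" using m by (simp add: minimal_Z_order_ideal_def)
  then obtain v where v: "v \<in> ideal_verts I" using ideal_verts_nonempty[OF I] by blast
  then have "v \<in> hereditary_saturated hull exitless_verts" "v \<in> verts G"
    using cyclic_Z_order_ideal_verts[OF c] by (auto simp: ideal_verts_def)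
  then have "exitless_verts \<inter> ideal_verts I \<noteq> {}"
    using hull_meets[OF _ _ v _ hereditary_saturated_ideal_verts[OF I], of exitless_verts]
      exitless_verts_hereditary by blast
  then obtain p w where p: "exitless_cycle G p" "w \<in> tail G ` set p" "w \<in> ideal_verts I"
    by (auto simp: exitless_verts_def)
  have "cycle_ideal p = I"
    using m cycle_ideal_subset[OF p(1) I p(2,3)] minimal_cycle_ideal[OF p(1)]
    unfolding minimal_Z_order_ideal_def by metis
  then show "I \<in> cycle_ideal ` {p. exitless_cycle G p}" using p by blast
next
  fix I assume "I \<in> cycle_ideal ` {p. exitless_cycle G p}"
  then show "I \<in> {I. cyclic_Z_order_ideal (talented_monoid G) I \<and>
      minimal_Z_order_ideal (talented_monoid G) I}"
    using cyclic_cycle_ideal minimal_cycle_ideal by blast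
qed

text \<open>Descendants of a vertex of \<open>p\<close> stay on \<open>p\<close> and end up on
  \<open>q\<close>. Rotated to a common vertex, both cycles equal its \<open>loop\<close>.\<close>

lemma rotate_eq_if_cycle_ideal_eq:
  assumes p: "exitless_cycle G p" and q: "exitless_cycle G q" and "cycle_ideal p = cycle_ideal q"
  obtains i j where "rotate i p = rotate j q"
proof -
  let ?H = "hereditary_saturated hull (tail G ` set q)"
  obtain v where v: "v \<in> tail G ` set p" using exitless_cycleD(1)[OF p] by (cases p) auto
  have V: "tail G ` set p \<subseteq> verts G"
    using exitless_cycle_tails_subset[OF p] exitless_verts_subset by blast
  have "hereditary_saturated hull (tail G ` set p) \<inter> verts G \<subseteq> ?H"
    using assms(3) ideal_of_subset_iff[OF hereditary_saturated_hull] unfolding cycle_ideal_def by blast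
  moreover have "tail G ` set p \<subseteq> hereditary_saturated hull (tail G ` set p)" by (rule hull_subset)
  ultimately have "v \<in> ?H" using v V by blast
  then obtain k where k: "descendants k v \<subseteq> tail G ` set q"
    using hull_descendants[OF exitless_cycle_hereditary[OF q]] by blast
  moreover have "descendants k v \<subseteq> tail G ` set p"
    using descendants_hereditary[OF exitless_cycle_hereditary[OF p], of 0 v k] v by simp
  ultimately obtain w where "w \<in> tail G ` set p" "w \<in> tail G ` set q"
    using descendants_nonempty[of k v] by blast
  then obtain i j where "i < length p" "w = tail G (p ! i)" "j < length q" "w = tail G (q ! j)"
    by (auto simp: in_set_conv_nth)
  then have "rotate i p = rotate j q"
    using exitless_cycle_rotate_eq_loop[OF p] exitless_cycle_rotate_eq_loop[OF q] by metis
  then show ?thesis by (rule that)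
qed

section \<open>The sum of the cyclic minimal ideals and the largest cyclic ideal\<close>

lemma finprod_word_class:
  assumes "finite \<F>" and "\<And>J. J \<in> \<F> \<Longrightarrow> f J \<in> talented_words G"
  shows "finprod (talented_monoid G) (\<lambda>J. word_class (f J)) \<F> = word_class (sum f \<F>) \<and>
    sum f \<F> \<in> talented_words G"
  using assms
proof (induction \<F> rule: finite_induct)
  case empty
  interpret Z_monoid "talented_monoid G" by (rule Z_monoid_talented_monoid)
  show ?case by (simp add: one_talented_monoid)
next
  case (insert J \<F>)
  interpret Z_monoid "talented_monoid G" by (rule Z_monoid_talented_monoid)
  have "finprod (talented_monoid G) (\<lambda>J. word_class (f J)) (insert J \<F>) =
      word_class (f J) \<otimes>\<^bsub>talented_monoid G\<^esub>
      finprod (talented_monoid G) (\<lambda>J. word_class (f J)) \<F>"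
    using insert by (intro finprod_insert) (auto simp: carrier_talented_monoid)
  then show ?case
    using insert by (simp add: talented_class_mult)
qed

lemma finprod_in_submonoid:
  assumes "comm_monoid M" and I: "submonoid I M" and "finite A" and "\<And>a. a \<in> A \<Longrightarrow> f a \<in> I"
  shows "finprod M f A \<in> I"
  using assms(3,4)
proof (induction A rule: finite_induct)
  case empty
  then show ?case using submonoid.one_closed[OF I] comm_monoid.finprod_empty[OF assms(1)] by metis
next
  case (insert a A)
  have "f a \<in> carrier M" "f \<in> A \<rightarrow> carrier M"
    using insert.prems submonoid.subset[OF I] by blast+
  then have "finprod M f (insert a A) = f a \<otimes>\<^bsub>M\<^esub> finprod M f A"
    using insert.hyps by (intro comm_monoid.finprod_insert[OF assms(1)])
  then show ?case
    using submonoid.m_closed[OF I] insert by simp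
qed

text \<open>Each cycle ideal lies in the ideal on the right, which is closed under sums. Conversely,
  an element unfolds to a word over \<open>exitless_verts\<close>, whose letters are grouped by
  cycle ideals.\<close>

lemma family_sum_cyclic_minimal:
  "family_sum (talented_monoid G) (cycle_ideal ` {p. exitless_cycle G p}) =
   ideal_of (hereditary_saturated hull exitless_verts)"
proof (intro equalityI subsetI)
  fix z assume "z \<in> family_sum (talented_monoid G) (cycle_ideal ` {p. exitless_cycle G p})"
  then obtain f \<F> where z: "z = finprod (talented_monoid G) f \<F>" "finite \<F>"
    "\<F> \<subseteq> cycle_ideal ` {p. exitless_cycle G p}" "\<forall>J\<in>\<F>. f J \<in> J"
    by (auto simp: family_sum_def)
  have "cycle_ideal p \<subseteq> ideal_of (hereditary_saturated hull exitless_verts)"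
    if "exitless_cycle G p" for p
    unfolding cycle_ideal_def ideal_of_subset_iff[OF hereditary_saturated_hull]
    by (rule le_infI1[OF hull_mono[OF exitless_cycle_tails_subset[OF that]]])
  then have "f J \<in> ideal_of (hereditary_saturated hull exitless_verts)" if "J \<in> \<F>" for J
    using z that by blast
  moreover have "submonoid (ideal_of (hereditary_saturated hull exitless_verts)) (talented_monoid G)"
    using Z_order_ideal_ideal_of[OF hereditary_saturated_hull] by (simp add: Z_order_ideal_def)
  ultimately show "z \<in> ideal_of (hereditary_saturated hull exitless_verts)"
    unfolding z(1)
    by (intro finprod_in_submonoid[OF Z_monoid.axioms(1)[OF Z_monoid_talented_monoid] _ z(2)])
next
  fix z assume "z \<in> ideal_of (hereditary_saturated hull exitless_verts)"
  then obtain x where x: "z = word_class x" "x \<in> talented_words G"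
    "fst ` set_mset x \<subseteq> hereditary_saturated hull exitless_verts"
    by (auto simp: ideal_of_def)
  obtain y where y: "talented_cong G x y" "fst ` set_mset y \<subseteq> exitless_verts"
    using word_in_hull_cong[OF exitless_verts_hereditary x(2,3)] by blast
  have yw: "y \<in> talented_words G" using talented_cong_words[OF y(1)] by simp
  \<comment> \<open>Each letter chooses a cycle through its vertex. Its value is the ideal and not
    the cycle, because different rotations give the same ideal, which may contribute only one
    summand.\<close>
  define g where "g = (\<lambda>a :: 'a \<times> int. cycle_ideal (SOME p. exitless_cycle G p \<and> fst a \<in> tail G ` set p))"
  have g: "\<exists>p. exitless_cycle G p \<and> fst a \<in> tail G ` set p \<and> g a = cycle_ideal p" if "a \<in># y" for a
  proof -
    have "\<exists>p. exitless_cycle G p \<and> fst a \<in> tail G ` set p"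
      using y(2) that by (auto simp: exitless_verts_def)
    from someI_ex[OF this] show ?thesis unfolding g_def by blast
  qed
  let ?\<F> = "g ` set_mset y" and ?f = "\<lambda>J. filter_mset (\<lambda>a. g a = J) y"
  have fw: "?f J \<in> talented_words G" for J
    using yw by (auto simp: talented_words_def)
  have mem: "word_class (?f J) \<in> J" if J: "J \<in> ?\<F>" for J
  proof -
    have ideal: "Z_order_ideal (talented_monoid G) J"
    proof -
      obtain a where a: "a \<in># y" "J = g a" using J by (rule imageE)
      then obtain p where "exitless_cycle G p" "J = cycle_ideal p" using g[OF a(1)] by blast
      then show ?thesis using cyclic_cycle_ideal unfolding cyclic_Z_order_ideal_def by blast
    qed
    have "fst a \<in> ideal_verts J" if a: "a \<in># ?f J" for a
    proof -
      obtain p where p: "exitless_cycle G p" "fst a \<in> tail G ` set p" "J = cycle_ideal p"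
        using g[of a] a unfolding set_mset_filter mem_Collect_eq by blast
      have v: "fst a \<in> verts G" by (rule exitless_verts_next(1)[OF p(1,2)])
      have "word_class {#(fst a, 0)#} \<in> J"
        unfolding p(3) cycle_ideal_def
        using v p(2) by (simp add: word_class_in_ideal_of[OF _ hereditary_saturated_hull] hull_inc)
      then show ?thesis using v by (simp add: ideal_verts_def vertex_class_def)
    qed
    then show ?thesis unfolding Z_order_ideal_word_class_iff[OF ideal fw] by (rule image_subsetI)
  qed
  have "z = word_class (\<Sum>J\<in>?\<F>. ?f J)"
    unfolding x(1) word_class_cong[OF y(1)] sum_filter_mset_partition[OF finite_imageI[OF finite_set_mset] order_refl] ..
  also have "\<dots> = finprod (talented_monoid G) (\<lambda>J. word_class (?f J)) ?\<F>"
    using finprod_word_class[OF finite_imageI[OF finite_set_mset] fw] by (rule HOL.sym[OF conjunct1])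
  finally have "z = finprod (talented_monoid G) (\<lambda>J. word_class (?f J)) ?\<F>" .
  moreover have "?\<F> \<subseteq> cycle_ideal ` {p. exitless_cycle G p}" using g by blast
  moreover have "finite ?\<F>" by (rule finite_imageI[OF finite_set_mset])
  moreover have "\<forall>J\<in>?\<F>. word_class (?f J) \<in> J" using mem by (rule ballI)
  ultimately show "z \<in> family_sum (talented_monoid G) (cycle_ideal ` {p. exitless_cycle G p})"
    unfolding family_sum_def mem_Collect_eq by (intro exI conjI)
qed

lemma largest_cyclic_Z_order_ideal_of_exitless_verts:
  "largest_cyclic_Z_order_ideal (talented_monoid G)
     (ideal_of (hereditary_saturated hull exitless_verts))"
  unfolding largest_cyclic_Z_order_ideal_def
proof (intro conjI allI impI)
  show "cyclic_Z_order_ideal (talented_monoid G) (ideal_of (hereditary_saturated hull exitless_verts))"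
    by (rule cyclic_Z_order_ideal_of[OF hereditary_saturated_hull order_refl])
  fix J assume J: "cyclic_Z_order_ideal (talented_monoid G) J"
  then have "Z_order_ideal (talented_monoid G) J" by (simp add: cyclic_Z_order_ideal_def)
  then have "J = ideal_of (ideal_verts J)" by (simp add: ideal_of_ideal_verts)
  also have "\<dots> \<subseteq> ideal_of (hereditary_saturated hull exitless_verts)"
    unfolding ideal_of_subset_iff[OF hereditary_saturated_hull]
    by (rule le_infI1[OF cyclic_Z_order_ideal_verts[OF J]])
  finally show "J \<subseteq> ideal_of (hereditary_saturated hull exitless_verts)" .
qed

section \<open>The correspondence between exitless cycles and cyclic minimal ideals\<close>

lemma cycle_verts_rotation_class: "cycle_verts G (rotation_rel `` {p}) = tail G ` set p"
  by (auto simp: cycle_verts_def rotation_rel_def)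

lemma generated_cycle_verts:
  assumes "exitless_cycle G p"
  shows "generated_Z_order_ideal (talented_monoid G)
      (vertex_class G ` cycle_verts G (rotation_rel `` {p})) = cycle_ideal p"
  unfolding cycle_verts_rotation_class cycle_ideal_def
  by (rule generated_Z_order_ideal_eq[OF
        subset_trans[OF exitless_cycle_tails_subset[OF assms] exitless_verts_subset]])

text \<open>The class of \<open>p\<close> goes to \<open>cycle_ideal p\<close>, which settles
  surjectivity; cycles with equal ideals have a common rotation and so lie in one class.\<close>

lemma bij_betw_exitless_cycles:
  "bij_betw
     (\<lambda>C. generated_Z_order_ideal (talented_monoid G) (vertex_class G ` cycle_verts G C))
     (exitless_cycles G) (cycle_ideal ` {p. exitless_cycle G p})"
  unfolding bij_betw_def
proof (intro conjI inj_onI)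
  fix C D
  assume "C \<in> exitless_cycles G" "D \<in> exitless_cycles G"
    and eq: "generated_Z_order_ideal (talented_monoid G) (vertex_class G ` cycle_verts G C) =
      generated_Z_order_ideal (talented_monoid G) (vertex_class G ` cycle_verts G D)"
  then obtain p q where p: "C = rotation_rel `` {p}" "exitless_cycle G p"
    and q: "D = rotation_rel `` {q}" "exitless_cycle G q"
    by (auto simp: exitless_cycles_def quotient_def)
  have "cycle_ideal p = cycle_ideal q"
    using eq generated_cycle_verts p q by simp
  then obtain i j where "rotate i p = rotate j q"
    using rotate_eq_if_cycle_ideal_eq[OF p(2) q(2)] by blast
  moreover have "(p, rotate i p) \<in> rotation_rel" "(q, rotate j q) \<in> rotation_rel"
    by (auto simp: rotation_rel_def)
  ultimately show "C = D"
    using equiv_class_eq[OF equiv_rotation_rel] p(1) q(1) by metis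
next
  have "exitless_cycles G = (\<lambda>p. rotation_rel `` {p}) ` {p. exitless_cycle G p}"
    by (auto simp: exitless_cycles_def quotient_def)
  then show "(\<lambda>C. generated_Z_order_ideal (talented_monoid G) (vertex_class G ` cycle_verts G C)) `
      exitless_cycles G = cycle_ideal ` {p. exitless_cycle G p}"
    by (simp only: image_image) (rule image_cong[OF HOL.refl], rule generated_cycle_verts, erule CollectD)
qed

lemma Union_cycle_verts: "(\<Union>C\<in>exitless_cycles G. cycle_verts G C) = exitless_verts"
proof -
  have "exitless_cycles G = (\<lambda>p. rotation_rel `` {p}) ` {p. exitless_cycle G p}"
    by (auto simp: exitless_cycles_def quotient_def)
  then have "(\<Union>C\<in>exitless_cycles G. cycle_verts G C) = (\<Union>p\<in>{p. exitless_cycle G p}. tail G ` set p)"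
    by (simp add: cycle_verts_rotation_class)
  then show ?thesis unfolding exitless_verts_def by blast
qed

end

theorem theorem3p10:
  fixes G :: "('v, 'e) pre_digraph"
  assumes "fin_digraph G"
  shows "bij_betw
           (\<lambda>C. generated_Z_order_ideal (talented_monoid G) (vertex_class G ` cycle_verts G C))
           (exitless_cycles G)
           {I. cyclic_Z_order_ideal (talented_monoid G) I \<and>
               minimal_Z_order_ideal (talented_monoid G) I}
       \<and> family_sum (talented_monoid G)
           {I. cyclic_Z_order_ideal (talented_monoid G) I \<and>
               minimal_Z_order_ideal (talented_monoid G) I}
         = generated_Z_order_ideal (talented_monoid G)
             (vertex_class G ` (\<Union>C\<in>exitless_cycles G. cycle_verts G C))
       \<and> largest_cyclic_Z_order_ideal (talented_monoid G)
           (family_sum (talented_monoid G)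
             {I. cyclic_Z_order_ideal (talented_monoid G) I \<and>
                 minimal_Z_order_ideal (talented_monoid G) I})"
proof -
  interpret fin_digraph G by (rule assms)
  show ?thesis
    \<comment> \<open>Both sides of the middle claim become the ideal of the hull of
      \<open>exitless_verts\<close>.\<close>
    unfolding cyclic_minimal_Z_order_ideals family_sum_cyclic_minimal Union_cycle_verts
      generated_Z_order_ideal_eq[OF exitless_verts_subset]
    using bij_betw_exitless_cycles largest_cyclic_Z_order_ideal_of_exitless_verts by blast
qed

end
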